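(* Let $\mu$ be a non-trivial probability measure supported on $[-1,1]$ with $\mathcal S$-function $S$, and let $\sigma=\mathrm{Sz}(\mu)$ have Verblunsky coefficients $\{\alpha_n\}_{n\ge0}$. Let $k\ge1$, let $\xi_0,\dots,\xi_{k-1}\in(-1,1)$, and let $\{\Phi_n^{(-k)}\}_{n\ge0}$ be the anti-associated polynomials of order $k$ on the unit circle, i.e. the monic orthogonal polynomials with Verblunsky coefficients $\xi_0,\dots,\xi_{k-1},\alpha_0,\alpha_1,\dots$. Let $\tilde S^{(-k)}$ be the $\mathcal S$-function corresponding to them through the Szegő transformation. Then $$\sqrt{x^2-1}\,\tilde S^{(-k)}(x)\ \dot=\ \boldsymbol\Upsilon^{(-k)}\!\left(x-\sqrt{x^2-1}\right)\left(\sqrt{x^2-1}\,S(x)\right),$$ where $$\boldsymbol\Upsilon^{(-k)}(z)=\begin{bmatrix}\widetilde\Omega_k(z)+\widetilde\Omega_k^*(z)&\widetilde\Omega_k^*(z)-\widetilde\Omega_k(z)\\ \widetilde\Phi_k^*(z)-\widetilde\Phi_k(z)&\widetilde\Phi_k(z)+\widetilde\Phi_k^*(z)\end{bmatrix},\qquad z=x-\sqrt{x^2-1}.$$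
   Context: Notation $\dot=$: for a $2\times2$ matrix of functions, $f\ \dot=\ \begin{bmatrix}a&b\\c&d\end{bmatrix}g$ means $f=\dfrac{a g+b}{c g+d}$. The $\mathcal S$-function of a probability measure $\nu$ on $[-1,1]$ is $S_\nu(x)=\int\frac{d\nu(y)}{x-y}$, $x\in\mathbb C\setminus[-1,1]$. The branch of $\sqrt{x^2-1}$ on $\mathbb C\setminus[-1,1]$ is the one for which $|x-\sqrt{x^2-1}|<1$, so $2x=z+z^{-1}$ with $0<|z|<1$. For a non-trivial probability measure on the unit circle with monic orthogonal polynomials $\Phi_n$, the Verblunsky coefficients are $\alpha_n=-\overline{\Phi_{n+1}(0)}$, $n\ge0$, and $\Phi_{n+1}(z)=z\Phi_n(z)-\overline{\alpha_n}\Phi_n^*(z)$, $\Phi_0=1$. For a polynomial $Q_n$ of degree $n$ in such a sequence, $Q_n^*(z)=z^n\overline{Q_n(1/\bar z)}$. The second kind polynomials are obtained from the same recurrence with all Verblunsky coefficients multiplied by $-1$. Here $\widetilde\Phi_k=\Phi_k^{(-k)}$ is the degree-$k$ monic polynomial generated by the Verblunsky coefficients $\xi_0,\dots,\xi_{k-1}$, and $\widetilde\Omega_k$ is the corresponding degree-$k$ second kind polynomial (generated by $-\xi_0,\dots,-\xi_{k-1}$). Szegő transformation: a probability measure $\nu$ on $[-1,1]$ is sent to the probability measure $\mathrm{Sz}(\nu)$ on the unit circle given by $d\,\mathrm{Sz}(\nu)(\theta)=\frac12|d\nu(\cos\theta)|$, i.e. the measure invariant under $\theta\mapsto-\theta$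 whose push-forward under $e^{i\theta}\mapsto\cos\theta$ is $\nu$. Its Verblunsky coefficients are in $(-1,1)$, and each probability measure on the circle with all Verblunsky coefficients in $(-1,1)$ is $\mathrm{Sz}(\nu)$ for a unique $\nu$. $\tilde S^{(-k)}$ is the $\mathcal S$-function of the measure $\tilde\mu$ on $[-1,1]$ such that $\{\Phi_n^{(-k)}\}$ is orthogonal with respect to $\mathrm{Sz}(\tilde\mu)$. *)

theory Defs
  imports "HOL-Probability.Probability" "HOL-Computational_Algebra.Polynomial"
begin

section \<open>Probability measures on the interval and on the circle\<close>

text \<open>
  Measures on the interval (or the circle) are Borel measures on all of the reals (or the complex
  numbers) that live on that subset.
\<close>

definition prob_on :: "'a::topological_space set \<Rightarrow> 'a measure \<Rightarrow> bool" where
  "prob_on A M \<longleftrightarrow> prob_space M \<and> sets M = sets borel \<and> (AE x in M. x \<in> A)"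

definition nontrivial_measure :: "'a measure \<Rightarrow> bool" where
  "nontrivial_measure M \<longleftrightarrow> \<not> (\<exists>F. finite F \<and> (AE x in M. x \<in> F))"

definition S_function :: "real measure \<Rightarrow> complex \<Rightarrow> complex" where
  "S_function \<nu> x = (LINT y|\<nu>. 1 / (x - of_real y))"

definition sqrt_branch :: "complex \<Rightarrow> complex" where
  "sqrt_branch x = (THE w. w\<^sup>2 = x\<^sup>2 - 1 \<and> norm (x - w) < 1)"

lemma sqrt_branch_ex1:
  assumes "x \<notin> complex_of_real ` {-1..1}"
  shows "\<exists>!w. w\<^sup>2 = x\<^sup>2 - 1 \<and> norm (x - w) < 1"
proof -
  define w where "w = csqrt (x\<^sup>2 - 1)"
  have w2: "w\<^sup>2 = x\<^sup>2 - 1" by (simp add: w_def)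
  have prod1: "norm (x - v) * norm (x + v) = 1" if "v\<^sup>2 = x\<^sup>2 - 1" for v
  proof -
    have "(x - v) * (x + v) = 1"
      using that by (simp add: algebra_simps power2_eq_square)
    then show ?thesis by (metis norm_mult norm_one)
  qed
  have ne1: "norm (x - w) \<noteq> 1"
  proof
    assume n: "norm (x - w) = 1"
    have "(x - w) * (x + w) = 1"
      using w2 by (simp add: algebra_simps power2_eq_square)
    moreover have "(x - w) * cnj (x - w) = 1"
      using n complex_norm_square[of "x - w"] by simp
    moreover have "x - w \<noteq> 0" using n by auto
    ultimately have "x + w = cnj (x - w)" by (metis mult_left_cancel)
    then have "2 * x = (x - w) + cnj (x - w)"
      by (metis (no_types, lifting) add.commute diff_add_cancel add.left_commute mult_2)
    also have "\<dots> = of_real (2 * Re (x - w))" by (rule complex_add_cnj)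
    finally have "2 * x = 2 * of_real (Re (x - w))" by (simp only: of_real_mult of_real_numeral)
    then have "x = of_real (Re (x - w))" by (metis mult_left_cancel zero_neq_numeral)
    moreover have "Re (x - w) \<in> {-1..1}"
      using abs_Re_le_cmod[of "x - w"] n by (simp add: abs_le_iff)
    ultimately show False using assms by blast
  qed
  have "\<exists>w. w\<^sup>2 = x\<^sup>2 - 1 \<and> norm (x - w) < 1"
  proof (cases "norm (x - w) < 1")
    case True
    then show ?thesis using w2 by blast
  next
    case False
    then have g: "norm (x - w) > 1" using ne1 by simp
    have "norm (x - (- w)) < 1"
    proof (rule ccontr)
      assume "\<not> norm (x - (- w)) < 1"
      then have "norm (x + w) \<ge> 1" by simp
      then have "norm (x - w) * norm (x + w) \<ge> norm (x - w) * 1"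
        by (intro mult_left_mono) auto
      then show False using g prod1[OF w2] by simp
    qed
    then show ?thesis using w2 by (intro exI[of _ "- w"]) simp
  qed
  moreover have "v = u" if "v\<^sup>2 = x\<^sup>2 - 1 \<and> norm (x - v) < 1"
    "u\<^sup>2 = x\<^sup>2 - 1 \<and> norm (x - u) < 1" for u v
  proof (rule ccontr)
    assume "v \<noteq> u"
    then have "v = - u" using that by (metis power2_eq_iff)
    then have "norm (x + u) < 1" using that by simp
    then have "norm (x - u) * norm (x + u) < 1 * 1"
      using that by (intro mult_strict_mono') auto
    then show False using prod1[of u] that by simp
  qed
  ultimately show ?thesis by blast
qed


section \<open>The Szego transformation\<close>

text \<open>
  The point \<open>x = cos \<theta>\<close> is lifted to one of \<open>exp (\<plusminus>i\<theta>) = x \<plusminus> i sqrt (1 - x\<^sup>2)\<close>, each with weight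
  one half: the second factor of the product measure is a uniformly distributed sign.
\<close>

definition Szego :: "real measure \<Rightarrow> complex measure" where
  "Szego \<nu> = distr (\<nu> \<Otimes>\<^sub>M uniform_count_measure {-1, 1}) borel
                (\<lambda>(x, e). Complex x (e * sqrt (1 - x\<^sup>2)))"

lemma measurable_circle_lift [measurable]:
  "(\<lambda>(x, e). Complex x (e * sqrt (1 - x\<^sup>2)))
     \<in> borel_measurable (borel \<Otimes>\<^sub>M uniform_count_measure {-1, 1})"
proof -
  have "(\<lambda>e. e) \<in> borel_measurable (uniform_count_measure {-1, 1 :: real})"
    by (auto simp: measurable_def space_uniform_count_measure sets_uniform_count_measure)
  then have [measurable]: "snd \<in> borel_measurable (borel \<Otimes>\<^sub>M uniform_count_measure {-1, 1 :: real})"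
    by (rule measurable_compose[OF measurable_snd])
  have "(\<lambda>p. complex_of_real (fst p) + \<i> * complex_of_real (snd p * sqrt (1 - (fst p)\<^sup>2)))
          \<in> borel_measurable (borel \<Otimes>\<^sub>M uniform_count_measure {-1, 1 :: real})"
    by measurable
  then show ?thesis
    by (simp add: Complex_eq case_prod_beta)
qed

lemma sets_Szego [simp]: "sets (Szego \<nu>) = sets borel"
  and space_Szego [simp]: "space (Szego \<nu>) = UNIV"
  by (simp_all add: Szego_def)

lemma nn_integral_Szego:
  assumes "prob_on {-1..1} \<nu>" and [measurable]: "f \<in> borel_measurable borel"
  shows "(\<integral>\<^sup>+z. f z \<partial>Szego \<nu>) =
    ((\<integral>\<^sup>+x. f (Complex x (sqrt (1 - x\<^sup>2))) \<partial>\<nu>) + (\<integral>\<^sup>+x. f (Complex x (- sqrt (1 - x\<^sup>2))) \<partial>\<nu>)) / 2"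
proof -
  interpret N: prob_space \<nu> using assms by (simp add: prob_on_def)
  have s [measurable_cong]: "sets \<nu> = sets borel" using assms by (simp add: prob_on_def)
  let ?U = "uniform_count_measure {-1, 1 :: real}"
  interpret U: prob_space ?U by (rule prob_space_uniform_count_measure) auto
  interpret P: pair_sigma_finite \<nu> ?U ..
  have m: "(\<lambda>(x, e). Complex x (e * sqrt (1 - x\<^sup>2))) \<in> borel_measurable (\<nu> \<Otimes>\<^sub>M ?U)"
    using measurable_circle_lift by (simp cong: measurable_cong_sets add: s)
  have m': "(\<lambda>(x, e). f (Complex x (e * sqrt (1 - x\<^sup>2)))) \<in> borel_measurable (\<nu> \<Otimes>\<^sub>M ?U)"
    using measurable_compose[OF m assms(2)] by (simp add: case_prod_beta)
  have "(\<integral>\<^sup>+z. f z \<partial>Szego \<nu>) = (\<integral>\<^sup>+p. (\<lambda>(x, e). f (Complex x (e * sqrt (1 - x\<^sup>2)))) p \<partial>(\<nu> \<Otimes>\<^sub>M ?U))"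
    unfolding Szego_def by (subst nn_integral_distr[OF m]) (auto simp: case_prod_unfold)
  also have "\<dots> = (\<integral>\<^sup>+e. (\<integral>\<^sup>+x. f (Complex x (e * sqrt (1 - x\<^sup>2))) \<partial>\<nu>) \<partial>?U)"
    using P.nn_integral_snd[OF m'] by simp
  also have "\<dots> = (\<Sum>e\<in>{-1, 1}. ennreal (1 / 2) * (\<integral>\<^sup>+x. f (Complex x (e * sqrt (1 - x\<^sup>2))) \<partial>\<nu>))"
    unfolding uniform_count_measure_def by (subst nn_integral_point_measure_finite) (auto simp: mult.commute)
  also have "ennreal (1 / 2) = inverse 2"
    by (metis ennreal_numeral inverse_ennreal inverse_eq_divide zero_le_numeral zero_less_numeral)
  finally show ?thesis
    by (simp add: divide_ennreal_def algebra_simps)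
qed

text \<open>
  The image of \<open>\<nu>\<close> is the only measure on the circle that is invariant under conjugation and
  has \<open>\<nu>\<close> as its push-forward under \<open>exp (i\<theta>) \<mapsto> cos \<theta>\<close>.
\<close>

theorem Szego_characterization:
  assumes \<nu>: "prob_on {-1..1} \<nu>"
  shows "\<sigma> = Szego \<nu> \<longleftrightarrow>
    prob_on (sphere 0 1) \<sigma> \<and> distr \<sigma> borel cnj = \<sigma> \<and> distr \<sigma> borel Re = \<nu>"
proof -
  have s [measurable_cong]: "sets \<nu> = sets borel" and sp: "space \<nu> = UNIV"
    using \<nu> sets_eq_imp_space_eq[of \<nu> borel] by (auto simp: prob_on_def)
  have AE\<nu>: "AE x in \<nu>. x \<in> {-1..1}" and N: "prob_space \<nu>" using \<nu> by (auto simp: prob_on_def)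
  have cnj_m [measurable]: "cnj \<in> borel_measurable borel"
    by (intro borel_measurable_continuous_onI continuous_intros)
  have up [measurable]: "(\<lambda>x. Complex x (sqrt (1 - x\<^sup>2))) \<in> borel_measurable borel"
    and lo [measurable]: "(\<lambda>x. Complex x (- sqrt (1 - x\<^sup>2))) \<in> borel_measurable borel"
    unfolding Complex_eq by measurable
  have "AE x in \<nu>. x\<^sup>2 \<le> 1"
    using AE\<nu> by eventually_elim (auto simp: abs_square_le_1 abs_le_iff)
  define I where "I h = (\<integral>\<^sup>+x. h x \<partial>\<nu>)" for h :: "real \<Rightarrow> ennreal"
  have em: "emeasure (Szego \<nu>) E = (I (\<lambda>x. indicator E (Complex x (sqrt (1 - x\<^sup>2))))
      + I (\<lambda>x. indicator E (Complex x (- sqrt (1 - x\<^sup>2))))) / 2"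
    if [measurable]: "E \<in> sets borel" for E
    using nn_integral_Szego[OF \<nu>, of "indicator E"] that by (simp add: I_def)
  have half: "(a + a) / 2 = a" for a :: ennreal
    by (simp add: mult_2[symmetric] ennreal_mult_divide_eq mult.commute)
  have Re_m: "Re \<in> borel_measurable (Szego \<nu>)"
    by (simp cong: measurable_cong_sets)
  have Re: "distr (Szego \<nu>) borel Re = \<nu>"
  proof (rule measure_eqI)
    fix A assume "A \<in> sets (distr (Szego \<nu>) borel Re)"
    then have [measurable]: "A \<in> sets borel" by simp
    have E: "Re -` A \<in> sets borel" using measurable_sets_borel[of Re borel A] by simp
    have c: "indicator (Re -` A) z = (indicator A (Re z) :: ennreal)" for z
      by (simp add: indicator_def)
    show "emeasure (distr (Szego \<nu>) borel Re) A = emeasure \<nu> A"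
      using emeasure_distr[OF Re_m, of A] em[OF E] by (simp add: c I_def half s)
  qed (simp add: s)
  have cnj_S: "cnj \<in> borel_measurable (Szego \<nu>)"
    using cnj_m by (simp cong: measurable_cong_sets)
  have cnj: "distr (Szego \<nu>) borel cnj = Szego \<nu>"
  proof (rule measure_eqI)
    fix A assume "A \<in> sets (distr (Szego \<nu>) borel cnj)"
    then have [measurable]: "A \<in> sets borel" by simp
    have E: "cnj -` A \<in> sets borel" using measurable_sets_borel[of cnj borel A] by simp
    have c: "indicator (cnj -` A) z = (indicator A (cnj z) :: ennreal)" for z
      by (simp add: indicator_def)
    show "emeasure (distr (Szego \<nu>) borel cnj) A = emeasure (Szego \<nu>) A"
      using emeasure_distr[OF cnj_S, of A] em[OF E] by (simp add: em c complex_cnj add.commute)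
  qed simp
  have circ: "prob_on (sphere 0 1) (Szego \<nu>)"
  proof -
    have "emeasure (Szego \<nu>) UNIV = emeasure (distr (Szego \<nu>) borel Re) UNIV"
      using emeasure_distr[OF Re_m, of UNIV] by simp
    also have "\<dots> = 1"
      using prob_space.emeasure_space_1[OF N] by (simp add: Re sp)
    finally have 1: "prob_space (Szego \<nu>)" by (intro prob_spaceI) simp
    have z: "I (\<lambda>x. indicator (- sphere 0 1) (Complex x (t * sqrt (1 - x\<^sup>2)))) = 0" if "t\<^sup>2 = 1" for t
      unfolding I_def
    proof (rule nn_integral_0_iff_AE[THEN iffD2])
      show "AE x in \<nu>. indicator (- sphere 0 1) (Complex x (t * sqrt (1 - x\<^sup>2))) = (0::ennreal)"
        using \<open>AE x in \<nu>. x\<^sup>2 \<le> 1\<close>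
        by eventually_elim (use that in \<open>simp add: cmod_def power_mult_distrib\<close>)
      have [measurable]: "- sphere 0 (1::real) \<in> sets (borel :: complex measure)"
        by (intro borel_open open_Compl closed_sphere)
      show "(\<lambda>x. indicator (- sphere 0 1) (Complex x (t * sqrt (1 - x\<^sup>2)))) \<in> borel_measurable \<nu>"
        unfolding Complex_eq by measurable
    qed
    have "emeasure (Szego \<nu>) (- sphere 0 1) = 0"
      using z[of 1] z[of "-1"] by (simp add: em borel_open open_Compl)
    then have "AE z in Szego \<nu>. z \<in> sphere 0 1"
      by (intro AE_I[of _ _ "- sphere 0 1"]) (auto simp: borel_open open_Compl)
    then show ?thesis using 1 by (simp add: prob_on_def)
  qed
  have uniq: "\<sigma> = Szego \<nu>"
    if \<sigma>: "prob_on (sphere 0 1) \<sigma>" and c: "distr \<sigma> borel cnj = \<sigma>" and r: "distr \<sigma> borel Re = \<nu>"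
  proof (rule measure_eqI)
    have s\<sigma> [measurable_cong]: "sets \<sigma> = sets borel" and AE\<sigma>: "AE z in \<sigma>. z \<in> sphere 0 1"
      using \<sigma> by (auto simp: prob_on_def)
    show "sets \<sigma> = sets (Szego \<nu>)" by (simp add: s\<sigma>)
    fix E assume "E \<in> sets \<sigma>"
    then have [measurable]: "E \<in> sets borel" by (simp add: s\<sigma>)
    define h :: "complex \<Rightarrow> ennreal" where "h z = indicator E (Complex (Re z) (sqrt (1 - (Re z)\<^sup>2)))
        + indicator E (Complex (Re z) (- sqrt (1 - (Re z)\<^sup>2)))" for z
    have "emeasure \<sigma> E + emeasure \<sigma> E = emeasure \<sigma> E + emeasure (distr \<sigma> borel cnj) E"
      by (simp add: c)
    also have "\<dots> = (\<integral>\<^sup>+z. indicator E z \<partial>\<sigma>) + (\<integral>\<^sup>+z. indicator E (cnj z) \<partial>\<sigma>)"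
      by (simp add: nn_integral_distr s\<sigma> flip: nn_integral_indicator)
    also have "\<dots> = (\<integral>\<^sup>+z. indicator E z + indicator E (cnj z) \<partial>\<sigma>)"
      by (rule nn_integral_add[symmetric]) measurable
    also have "\<dots> = (\<integral>\<^sup>+z. h z \<partial>\<sigma>)"
    proof (rule nn_integral_cong_AE)
      show "AE z in \<sigma>. indicator E z + indicator E (cnj z) = h z"
        using AE\<sigma>
      proof eventually_elim
        case (elim z)
        then have "(Re z)\<^sup>2 + (Im z)\<^sup>2 = 1" by (simp add: cmod_def)
        then have "sqrt (1 - (Re z)\<^sup>2) = \<bar>Im z\<bar>" by (simp flip: real_sqrt_abs)
        then show ?case
          by (cases z) (auto simp: h_def abs_if complex_cnj add.commute)
      qed
    qed
    also have "\<dots> = I (\<lambda>x. indicator E (Complex x (sqrt (1 - x\<^sup>2)))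
        + indicator E (Complex x (- sqrt (1 - x\<^sup>2))))"
      unfolding I_def h_def by (subst r[symmetric], subst nn_integral_distr) auto
    also have "\<dots> = I (\<lambda>x. indicator E (Complex x (sqrt (1 - x\<^sup>2))))
        + I (\<lambda>x. indicator E (Complex x (- sqrt (1 - x\<^sup>2))))"
      unfolding I_def by (rule nn_integral_add) measurable
    finally show "emeasure \<sigma> E = emeasure (Szego \<nu>) E"
      using half[of "emeasure \<sigma> E"] by (simp add: em)
  qed
  show ?thesis using Re cnj circ uniq by blast
qed


section \<open>Orthogonal polynomials on the unit circle\<close>

definition monic_OPs :: "complex measure \<Rightarrow> (nat \<Rightarrow> complex poly) \<Rightarrow> bool" where
  "monic_OPs \<sigma> \<Phi> \<longleftrightarrow>
     (\<forall>n. degree (\<Phi> n) = n \<and> lead_coeff (\<Phi> n) = 1) \<and>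
     (\<forall>m n. m \<noteq> n \<longrightarrow> (LINT z|\<sigma>. poly (\<Phi> m) z * cnj (poly (\<Phi> n) z)) = 0)"

text \<open>
  For a non-trivial measure on the circle there is exactly one such sequence; for a trivial one
  the following value is meaningless.
\<close>

definition verblunsky :: "complex measure \<Rightarrow> nat \<Rightarrow> complex" where
  "verblunsky \<sigma> n = - cnj (poly ((THE \<Phi>. monic_OPs \<sigma> \<Phi>) (Suc n)) 0)"

text \<open>
  The reversed polynomial with respect to the actual degree. The recurrence below only
  applies it to the monic polynomial of degree exactly \<open>n\<close>.
\<close>

definition star :: "complex poly \<Rightarrow> complex poly" where
  "star p = map_poly cnj (reflect_poly p)"

lemma poly_star:
  assumes "z \<noteq> 0"
  shows "poly (star p) z = z ^ degree p * cnj (poly p (1 / cnj z))"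
proof -
  have "poly (star p) z = cnj (poly (reflect_poly p) (cnj z))"
    unfolding star_def by (metis complex_cnj_cnj poly_cnj)
  then show ?thesis using assms by (simp add: poly_reflect_poly_nz divide_inverse)
qed

fun szego_poly :: "(nat \<Rightarrow> complex) \<Rightarrow> nat \<Rightarrow> complex poly" where
  "szego_poly \<alpha> 0 = 1"
| "szego_poly \<alpha> (Suc n) = [:0, 1:] * szego_poly \<alpha> n - smult (cnj (\<alpha> n)) (star (szego_poly \<alpha> n))"

lemma degree_szego_poly: "degree (szego_poly \<alpha> n) = n \<and> lead_coeff (szego_poly \<alpha> n) = 1"
proof (induction n)
  case (Suc n)
  let ?p = "szego_poly \<alpha> n" and ?q = "szego_poly \<alpha> (Suc n)"
  have "degree (star ?p) \<le> n"
    unfolding star_def using degree_reflect_poly_le[of ?p] Suc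
    by (intro degree_le) (auto simp: coeff_map_poly intro!: coeff_eq_0)
  then have r: "coeff (star ?p) j = 0" if "j > n" for j
    using that by (intro coeff_eq_0) simp
  have "degree ?p = n" "coeff ?p n = 1" using Suc by metis+
  then have c: "coeff ?q (Suc n) = 1" using r by simp
  have "degree ?q \<le> Suc n"
    by (rule degree_le) (use r Suc in \<open>auto simp: coeff_pCons split: nat.split intro!: coeff_eq_0\<close>)
  moreover have "degree ?q \<ge> Suc n" by (rule le_degree) (use c in simp)
  ultimately show ?case using c by (metis le_antisym)
qed simp

definition second_kind_poly :: "(nat \<Rightarrow> complex) \<Rightarrow> nat \<Rightarrow> complex poly" where
  "second_kind_poly \<alpha> n = szego_poly (\<lambda>j. - \<alpha> j) n"

definition anti_associated_coeff :: "nat \<Rightarrow> (nat \<Rightarrow> complex) \<Rightarrow> (nat \<Rightarrow> complex) \<Rightarrow> nat \<Rightarrow> complex" where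
  "anti_associated_coeff k \<xi> \<alpha> n = (if n < k then \<xi> n else \<alpha> (n - k))"

definition anti_associated_poly :: "nat \<Rightarrow> (nat \<Rightarrow> complex) \<Rightarrow> (nat \<Rightarrow> complex) \<Rightarrow> nat \<Rightarrow> complex poly" where
  "anti_associated_poly k \<xi> \<alpha> n = szego_poly (anti_associated_coeff k \<xi> \<alpha>) n"


section \<open>Linear fractional relation and the transfer matrix\<close>

text \<open>
  \<open>f \<doteq> M g\<close>, including the claim that the quotient is defined.
\<close>

definition lin_frac_eq :: "complex \<Rightarrow> complex^2^2 \<Rightarrow> complex \<Rightarrow> bool" where
  "lin_frac_eq f M g \<longleftrightarrow>
     M $ 2 $ 1 * g + M $ 2 $ 2 \<noteq> 0 \<and>
     f = (M $ 1 $ 1 * g + M $ 1 $ 2) / (M $ 2 $ 1 * g + M $ 2 $ 2)"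

definition Upsilon :: "nat \<Rightarrow> (nat \<Rightarrow> complex) \<Rightarrow> complex \<Rightarrow> complex^2^2" where
  "Upsilon k \<xi> z =
     (let \<Phi> = poly (szego_poly \<xi> k) z; \<Phi>s = poly (star (szego_poly \<xi> k)) z;
          \<Omega> = poly (second_kind_poly \<xi> k) z; \<Omega>s = poly (star (second_kind_poly \<xi> k)) z
      in vector [vector [\<Omega> + \<Omega>s, \<Omega>s - \<Omega>],
                 vector [\<Phi>s - \<Phi>, \<Phi> + \<Phi>s]])"

end

theory Submission
  imports Defs
begin

text \<open>
  With \<open>2x = z + 1/z\<close>, the function \<open>sqrt (x\<^sup>2 - 1) S(x)\<close> is the Caratheodory function \<open>F(z)\<close> of the
  Szego transform. For a measure on the circle with first and second kind polynomials
  \<open>\<Phi>\<^sub>n\<close> and \<open>\<Psi>\<^sub>n\<close>, the remainder \<open>\<Phi>\<^sub>n\<^sup>* F - \<Psi>\<^sub>n\<^sup>*\<close> equals \<open>2 z\<^bsup>n+1\<^esup> \<integral> cnj (\<Phi>\<^sub>n \<zeta>) / (\<zeta> - z) d\<sigma>\<close>, hence is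
  \<open>O(|z|\<^sup>n \<parallel>\<Phi>\<^sub>n\<parallel>)\<close>, while \<open>|\<Phi>\<^sub>n\<^sup>*(z)|\<^sup>2 \<ge> (1 - |z|\<^sup>2) \<parallel>\<Phi>\<^sub>n\<parallel>\<^sup>2\<close>; so \<open>\<Psi>\<^sub>n\<^sup>* / \<Phi>\<^sub>n\<^sup>*\<close> tends to \<open>F\<close>. The transfer
  matrices show that \<open>\<Upsilon>\<close> maps \<open>\<Psi>\<^sub>n\<^sup>* / \<Phi>\<^sub>n\<^sup>*\<close> for the coefficients \<open>\<alpha>\<close> exactly to the quotient of
  degree \<open>k + n\<close> for \<open>\<xi>, \<alpha>\<close>, and the limit \<open>n \<rightarrow> \<infinity>\<close> is the claim. The denominator cannot vanish
  because \<open>det \<Upsilon> = 4 z\<^sup>k \<Prod> (1 - \<xi>\<^sub>j\<^sup>2) \<noteq> 0\<close>.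
\<close>

section \<open>Integration against probability measures on the circle\<close>

lemma prob_onD:
  assumes "prob_on A \<sigma>"
  shows "prob_space \<sigma>" "sets \<sigma> = sets borel" "AE \<zeta> in \<sigma>. \<zeta> \<in> A"
  using assms by (auto simp: prob_on_def)

text \<open>Continuity on the compact circle bounds \<open>f\<close> almost everywhere. Borel
  measurability is asked separately because \<open>\<sigma>\<close> is a measure on the whole plane,
  where a kernel such as \<open>1 / (\<zeta> - z)\<close> is not continuous.\<close>

lemma integrable_on_circle:
  fixes f :: "complex \<Rightarrow> 'b::{banach, second_countable_topology}"
  assumes \<sigma>: "prob_on (sphere 0 1) \<sigma>" and c: "continuous_on (sphere 0 1) f"
    and m: "f \<in> borel_measurable borel"
  shows "integrable \<sigma> f"
proof -
  interpret prob_space \<sigma> using prob_onD(1)[OF \<sigma>] .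
  have "bounded (f ` sphere 0 1)"
    by (intro compact_imp_bounded compact_continuous_image c compact_sphere)
  then obtain B where B: "\<And>\<zeta>. \<zeta> \<in> sphere 0 1 \<Longrightarrow> norm (f \<zeta>) \<le> B"
    unfolding bounded_iff by blast
  have "AE \<zeta> in \<sigma>. norm (f \<zeta>) \<le> B"
    using prob_onD(3)[OF \<sigma>] by eventually_elim (rule B)
  moreover have "f \<in> borel_measurable \<sigma>"
    using m by (simp cong: measurable_cong_sets add: prob_onD(2)[OF \<sigma>])
  ultimately show ?thesis by (intro integrable_const_bound[where B = B])
qed

lemma integrable_circle_kernel:
  fixes f :: "complex \<Rightarrow> complex"
  assumes \<sigma>: "prob_on (sphere 0 1) \<sigma>" and z: "norm z < 1" and f: "continuous_on UNIV f"
  shows "integrable \<sigma> (\<lambda>\<zeta>. f \<zeta> / (\<zeta> - z))"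
proof (rule integrable_on_circle[OF \<sigma>])
  have "\<zeta> - z \<noteq> 0" if "\<zeta> \<in> sphere 0 1" for \<zeta> using z that by auto
  then show "continuous_on (sphere 0 1) (\<lambda>\<zeta>. f \<zeta> / (\<zeta> - z))"
    by (intro continuous_on_divide continuous_on_diff continuous_on_id continuous_on_const
        continuous_on_subset[OF f]) auto
  have [measurable]: "f \<in> borel_measurable borel" by (rule borel_measurable_continuous_onI[OF f])
  show "(\<lambda>\<zeta>. f \<zeta> / (\<zeta> - z)) \<in> borel_measurable borel" by measurable
qed

lemma borel_measurable_poly [measurable (raw)]:
  fixes p :: "complex poly"
  shows "f \<in> borel_measurable M \<Longrightarrow> (\<lambda>x. poly p (f x)) \<in> borel_measurable M"
  by (rule borel_measurable_continuous_on) (intro continuous_intros)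

lemma borel_measurable_cnj [measurable (raw)]:
  "f \<in> borel_measurable M \<Longrightarrow> (\<lambda>x. cnj (f x)) \<in> borel_measurable M"
  by (rule borel_measurable_continuous_on) (intro continuous_intros)

text \<open>All mass sits on the circle, so integrands may be rewritten with
  \<open>\<zeta> * cnj \<zeta> = 1\<close>, and denominators \<open>\<zeta> - z\<close> with
  \<open>norm z < 1\<close> may be cleared.\<close>

lemma lint_cong_circle:
  fixes f g :: "complex \<Rightarrow> 'b::{banach, second_countable_topology}"
  assumes \<sigma>: "prob_on (sphere 0 1) \<sigma>"
    and [measurable]: "f \<in> borel_measurable borel" "g \<in> borel_measurable borel"
    and eq: "\<And>\<zeta>. norm \<zeta> = 1 \<Longrightarrow> f \<zeta> = g \<zeta>"
  shows "(LINT \<zeta>|\<sigma>. f \<zeta>) = (LINT \<zeta>|\<sigma>. g \<zeta>)"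
proof -
  note [measurable_cong] = prob_onD(2)[OF \<sigma>]
  have "AE \<zeta> in \<sigma>. f \<zeta> = g \<zeta>"
    using prob_onD(3)[OF \<sigma>] by eventually_elim (use eq in auto)
  then show ?thesis by (intro integral_cong_AE) auto
qed

section \<open>Reversed polynomials and the Szego recurrence\<close>

lemma complex_norm_power2: "(complex_of_real (norm z))\<^sup>2 = z * cnj z"
  by (metis complex_norm_square of_real_power)

lemma poly_star_circle:
  assumes "norm \<zeta> = 1"
  shows "poly (star p) \<zeta> = \<zeta> ^ degree p * cnj (poly p \<zeta>)"
proof -
  have "\<zeta> * cnj \<zeta> = 1" using assms complex_norm_square[of \<zeta>] by simp
  then have "1 / cnj \<zeta> = \<zeta>" by (metis nonzero_eq_divide_eq mult_zero_right zero_neq_one)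
  moreover have "\<zeta> \<noteq> 0" using assms by auto
  ultimately show ?thesis using poly_star[of \<zeta> p] by simp
qed

lemma poly_star_0: "poly (star p) 0 = cnj (lead_coeff p)"
  by (simp add: star_def poly_0_coeff_0 coeff_map_poly)

lemma degree_szego [simp]: "degree (szego_poly \<alpha> n) = n"
  and coeff_szego [simp]: "coeff (szego_poly \<alpha> n) n = 1"
  using degree_szego_poly[of \<alpha> n] by auto

lemma poly_szego_Suc:
  "poly (szego_poly \<alpha> (Suc n)) z =
     z * poly (szego_poly \<alpha> n) z - cnj (\<alpha> n) * poly (star (szego_poly \<alpha> n)) z"
  by simp

text \<open>The recurrence is evaluated at \<open>1 / cnj z\<close>, conjugated and multiplied by
  \<open>z ^ Suc n\<close>; reversing twice gives back the polynomial, which is the fact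
  \<open>s\<close>.\<close>

lemma poly_star_szego_Suc:
  assumes "z \<noteq> 0"
  shows "poly (star (szego_poly \<alpha> (Suc n))) z =
     poly (star (szego_poly \<alpha> n)) z - \<alpha> n * z * poly (szego_poly \<alpha> n) z"
proof -
  have s: "cnj (poly (star (szego_poly \<alpha> n)) (1 / cnj z)) = poly (szego_poly \<alpha> n) z / z ^ n"
    using assms poly_star[of "1 / cnj z" "szego_poly \<alpha> n"] by (simp add: power_divide)
  show ?thesis
    unfolding poly_star[OF assms] degree_szego poly_szego_Suc complex_cnj_diff complex_cnj_mult s
    using assms by (simp add: field_simps)
qed

lemma poly_star_one [simp]: "poly (star 1) z = 1"
  by (simp add: star_def)

lemma szego_poly_cong:
  "(\<And>j. j < n \<Longrightarrow> \<alpha> j = \<beta> j) \<Longrightarrow> szego_poly \<alpha> n = szego_poly \<beta> n"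
  by (induction n) auto

text \<open>For an orthogonal sequence this is the squared norm of its n-th member, see
  \<open>norm_square_integral\<close>. The product form also makes sense for coefficients that come
  without a measure, such as \<open>\<eta>\<close> in the theorem.\<close>

definition szego_weight :: "(nat \<Rightarrow> complex) \<Rightarrow> nat \<Rightarrow> real" where
  "szego_weight \<alpha> n = (\<Prod>j<n. 1 - (norm (\<alpha> j))\<^sup>2)"

lemma szego_weight_0 [simp]: "szego_weight \<alpha> 0 = 1"
  and szego_weight_Suc: "szego_weight \<alpha> (Suc n) = szego_weight \<alpha> n * (1 - (norm (\<alpha> n))\<^sup>2)"
  by (simp_all add: szego_weight_def)

text \<open>Each step of the recurrence multiplies the left side by the determinant
  \<open>z * (1 - \<alpha> n * cnj (\<alpha> n))\<close> of a transfer matrix. At degree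
  \<open>k\<close>, twice the left side is the determinant of \<open>Upsilon\<close>.\<close>

lemma szego_wronskian:
  assumes "z \<noteq> 0"
  shows "poly (second_kind_poly \<alpha> n) z * poly (star (szego_poly \<alpha> n)) z
       + poly (star (second_kind_poly \<alpha> n)) z * poly (szego_poly \<alpha> n) z
       = 2 * z ^ n * of_real (szego_weight \<alpha> n)"
proof (induction n)
  case 0
  then show ?case by (simp add: second_kind_poly_def)
next
  case (Suc n)
  let ?f = "poly (szego_poly \<alpha> n) z" and ?fs = "poly (star (szego_poly \<alpha> n)) z"
  let ?g = "poly (second_kind_poly \<alpha> n) z" and ?gs = "poly (star (second_kind_poly \<alpha> n)) z"
  have "poly (second_kind_poly \<alpha> (Suc n)) z * poly (star (szego_poly \<alpha> (Suc n))) z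
       + poly (star (second_kind_poly \<alpha> (Suc n))) z * poly (szego_poly \<alpha> (Suc n)) z
      = z * (1 - \<alpha> n * cnj (\<alpha> n)) * (?g * ?fs + ?gs * ?f)"
    unfolding second_kind_poly_def poly_szego_Suc poly_star_szego_Suc[OF assms]
    by (simp add: algebra_simps)
  also have "\<dots> = z * of_real (1 - (norm (\<alpha> n))\<^sup>2) * (2 * z ^ n * of_real (szego_weight \<alpha> n))"
    using Suc by (simp add: complex_norm_power2)
  finally show ?case by (simp add: szego_weight_Suc)
qed

text \<open>The transfer matrices of the stripped coefficients, applied to \<open>(1, \<plusminus>1)\<close>, produce the first
  and second kind polynomials; hence the product with the first \<open>k\<close> transfer matrices is
  read off by expanding in that basis.\<close>

lemma szego_poly_shift:
  assumes "z \<noteq> 0"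
  defines "f \<equiv> \<lambda>\<alpha> n. poly (szego_poly \<alpha> n) z" and "fs \<equiv> \<lambda>\<alpha> n. poly (star (szego_poly \<alpha> n)) z"
  shows "2 * f \<beta> (k + n) = (f \<beta> k + fs \<beta> k) * f (\<lambda>j. \<beta> (k + j)) n
          + (f \<beta> k - fs \<beta> k) * f (\<lambda>j. - \<beta> (k + j)) n \<and>
         2 * fs \<beta> (k + n) = (f \<beta> k + fs \<beta> k) * fs (\<lambda>j. \<beta> (k + j)) n
          + (fs \<beta> k - f \<beta> k) * fs (\<lambda>j. - \<beta> (k + j)) n"
proof (induction n)
  case 0
  then show ?case by (simp add: f_def fs_def algebra_simps)
next
  case (Suc n)
  have f: "f \<alpha> (Suc m) = z * f \<alpha> m - cnj (\<alpha> m) * fs \<alpha> m" for \<alpha> m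
    unfolding f_def fs_def by (rule poly_szego_Suc)
  have fs: "fs \<alpha> (Suc m) = fs \<alpha> m - \<alpha> m * z * f \<alpha> m" for \<alpha> m
    unfolding f_def fs_def by (rule poly_star_szego_Suc[OF assms(1)])
  have "2 * f \<beta> (k + Suc n) = z * (2 * f \<beta> (k + n)) - cnj (\<beta> (k + n)) * (2 * fs \<beta> (k + n))"
       "2 * fs \<beta> (k + Suc n) = 2 * fs \<beta> (k + n) - \<beta> (k + n) * z * (2 * f \<beta> (k + n))"
    by (simp_all add: f fs algebra_simps)
  note eqs = this Suc[THEN conjunct1] Suc[THEN conjunct2]
  show ?case unfolding eqs f fs by (simp add: algebra_simps)
qed

text \<open>One recurrence step turns \<open>|\<phi>s|^2 - |z|^2 |\<phi>|^2\<close> into the plain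
  difference of squares at degree n + 1, up to the factor \<open>1 - |\<alpha> n|^2\<close>. As
  \<open>|z| < 1\<close>, putting the factor \<open>|z|^2\<close> back on the subtracted term only
  enlarges that difference, and the induction closes.\<close>

lemma star_szego_lower_bound:
  assumes z: "z \<noteq> 0" "norm z < 1" and \<alpha>: "\<And>j. norm (\<alpha> j) < 1"
  shows "(norm (poly (star (szego_poly \<alpha> n)) z))\<^sup>2 - (norm z)\<^sup>2 * (norm (poly (szego_poly \<alpha> n) z))\<^sup>2
         \<ge> (1 - (norm z)\<^sup>2) * szego_weight \<alpha> n"
proof (induction n)
  case 0
  then show ?case by simp
next
  case (Suc n)
  define r where "r = (norm z)\<^sup>2"
  have r: "r \<le> 1" using z by (simp add: r_def abs_square_le_1)
  have a: "1 - (norm (\<alpha> n))\<^sup>2 \<ge> 0" using \<alpha>[of n] by (simp add: abs_square_le_1)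
  let ?f = "poly (szego_poly \<alpha> n) z" and ?fs = "poly (star (szego_poly \<alpha> n)) z"
  let ?F = "poly (szego_poly \<alpha> (Suc n)) z" and ?Fs = "poly (star (szego_poly \<alpha> (Suc n))) z"
  have "complex_of_real ((norm ?Fs)\<^sup>2 - (norm ?F)\<^sup>2) = of_real ((1 - (norm (\<alpha> n))\<^sup>2) * ((norm ?fs)\<^sup>2 - r * (norm ?f)\<^sup>2))"
    unfolding poly_szego_Suc poly_star_szego_Suc[OF z(1)] r_def
    by (simp add: complex_norm_power2 algebra_simps)
  then have eq: "(norm ?Fs)\<^sup>2 - (norm ?F)\<^sup>2 = (1 - (norm (\<alpha> n))\<^sup>2) * ((norm ?fs)\<^sup>2 - r * (norm ?f)\<^sup>2)"
    by (simp only: of_real_eq_iff)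
  have "(1 - r) * szego_weight \<alpha> (Suc n) = (1 - (norm (\<alpha> n))\<^sup>2) * ((1 - r) * szego_weight \<alpha> n)"
    by (simp add: szego_weight_Suc)
  also have "\<dots> \<le> (1 - (norm (\<alpha> n))\<^sup>2) * ((norm ?fs)\<^sup>2 - r * (norm ?f)\<^sup>2)"
    using Suc a unfolding r_def by (intro mult_left_mono) auto
  also have "\<dots> = (norm ?Fs)\<^sup>2 - (norm ?F)\<^sup>2" by (rule eq[symmetric])
  also have "\<dots> \<le> (norm ?Fs)\<^sup>2 - r * (norm ?F)\<^sup>2"
    using mult_right_mono[OF r, of "(norm ?F)\<^sup>2"] by simp
  finally show ?case by (simp add: r_def)
qed

section \<open>Orthogonality and norms\<close>

lemma integrable_poly_cnj:
  assumes "prob_on (sphere 0 1) \<sigma>"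
  shows "integrable \<sigma> (\<lambda>\<zeta>. poly p \<zeta> * cnj (poly q \<zeta>))"
  by (rule integrable_on_circle[OF assms]) (auto intro!: continuous_intros)

lemma monic_OPsD:
  assumes "monic_OPs \<sigma> \<Phi>"
  shows "degree (\<Phi> n) = n" "coeff (\<Phi> n) n = 1"
    "m \<noteq> n \<Longrightarrow> (LINT z|\<sigma>. poly (\<Phi> m) z * cnj (poly (\<Phi> n) z)) = 0"
proof -
  from assms have *: "degree (\<Phi> n) = n \<and> lead_coeff (\<Phi> n) = 1"
    unfolding monic_OPs_def by blast
  then show "degree (\<Phi> n) = n" by blast
  with * show "coeff (\<Phi> n) n = 1" by simp
  show "(LINT z|\<sigma>. poly (\<Phi> m) z * cnj (poly (\<Phi> n) z)) = 0" if "m \<noteq> n"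
    using that assms unfolding monic_OPs_def by simp
qed

text \<open>Subtracting the multiple of \<open>\<Phi> m\<close> with the same leading coefficient
  lowers the degree of \<open>q\<close>; strong induction handles the rest.\<close>

lemma monic_OPs_orthogonal:
  assumes \<sigma>: "prob_on (sphere 0 1) \<sigma>" and OP: "monic_OPs \<sigma> \<Phi>" and "degree q < n"
  shows "(LINT \<zeta>|\<sigma>. poly q \<zeta> * cnj (poly (\<Phi> n) \<zeta>)) = 0"
  using \<open>degree q < n\<close>
proof (induction "degree q" arbitrary: q rule: less_induct)
  case less
  define m where "m = degree q"
  define r where "r = q - smult (lead_coeff q) (\<Phi> m)"
  have \<Phi>: "degree (\<Phi> m) = m" "coeff (\<Phi> m) m = 1"
    using monic_OPsD[OF OP, of m] by auto
  have q: "q = smult (lead_coeff q) (\<Phi> m) + r" by (simp add: r_def)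
  have \<Phi>0: "(LINT \<zeta>|\<sigma>. poly (\<Phi> m) \<zeta> * cnj (poly (\<Phi> n) \<zeta>)) = 0"
    using less.prems by (intro monic_OPsD(3)[OF OP]) (simp add: m_def)
  have rI: "(LINT \<zeta>|\<sigma>. poly r \<zeta> * cnj (poly (\<Phi> n) \<zeta>)) = 0"
  proof (cases "m = 0")
    \<comment> \<open>The zero polynomial has degree 0, so for constant \<open>q\<close> the degree
      cannot drop; the remainder vanishes instead.\<close>
    case True
    have "degree r \<le> 0" unfolding r_def using True \<Phi> by (intro degree_diff_le) (auto simp: m_def)
    moreover have "coeff r 0 = 0" using \<Phi> True by (simp add: r_def m_def)
    ultimately have "r = 0" by (metis leading_coeff_0_iff le_zero_eq)
    then show ?thesis by simp
  next
    case False
    have "degree r < m"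
    proof (rule ccontr)
      assume n: "\<not> degree r < m"
      have "degree r \<le> m" unfolding r_def using \<Phi> by (intro degree_diff_le) (auto simp: m_def)
      then have "degree r = m" using n by simp
      moreover have "coeff r m = 0" using \<Phi> by (simp add: r_def m_def)
      ultimately show False using False by (metis leading_coeff_0_iff degree_0)
    qed
    then show ?thesis using less.hyps[of r] less.prems by (simp add: m_def)
  qed
  have "(LINT \<zeta>|\<sigma>. poly q \<zeta> * cnj (poly (\<Phi> n) \<zeta>)) =
      (LINT \<zeta>|\<sigma>. lead_coeff q * (poly (\<Phi> m) \<zeta> * cnj (poly (\<Phi> n) \<zeta>)) + poly r \<zeta> * cnj (poly (\<Phi> n) \<zeta>))"
    by (subst q) (simp add: algebra_simps)
  also have "\<dots> = 0"
    using rI \<Phi>0 by (subst Bochner_Integration.integral_add)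
      (simp_all add: integrable_poly_cnj[OF \<sigma>])
  finally show ?case .
qed

lemma integrable_poly:
  fixes p :: "complex poly"
  assumes "prob_on (sphere 0 1) \<sigma>"
  shows "integrable \<sigma> (poly p)"
  using integrable_poly_cnj[OF assms, of p 1] by simp

text \<open>It is instantiated twice: for \<open>Szego \<mu>\<close> with its Verblunsky
  coefficients, and for \<open>Szego \<mu>'\<close> with the anti-associated ones, where
  orthogonality is a hypothesis of the theorem.\<close>

locale circle_OPs =
  fixes \<sigma> :: "complex measure" and \<alpha> :: "nat \<Rightarrow> complex"
  assumes \<sigma>: "prob_on (sphere 0 1) \<sigma>" and OP: "monic_OPs \<sigma> (szego_poly \<alpha>)"
begin

abbreviation "\<phi> \<equiv> szego_poly \<alpha>"

sublocale prob_space \<sigma> using prob_onD(1)[OF \<sigma>] .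

lemma orth: "degree q < n \<Longrightarrow> (LINT \<zeta>|\<sigma>. poly q \<zeta> * cnj (poly (\<phi> n) \<zeta>)) = 0"
  by (rule monic_OPs_orthogonal[OF \<sigma> OP])

lemma integral_Suc_0: "(LINT \<zeta>|\<sigma>. poly (\<phi> (Suc n)) \<zeta>) = 0"
  using orth[of 1 "Suc n"] by (simp del: szego_poly.simps)

text \<open>This is the recurrence integrated, since \<open>\<phi> (Suc n)\<close> is orthogonal to
  constants.\<close>

lemma integral_shift:
  "(LINT \<zeta>|\<sigma>. \<zeta> * poly (\<phi> n) \<zeta>) = cnj (\<alpha> n) * (LINT \<zeta>|\<sigma>. poly (star (\<phi> n)) \<zeta>)"
proof -
  have "0 = (LINT \<zeta>|\<sigma>. poly ([:0, 1:] * \<phi> n) \<zeta> - poly (smult (cnj (\<alpha> n)) (star (\<phi> n))) \<zeta>)"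
    using integral_Suc_0[of n] by simp
  also have "\<dots> = (LINT \<zeta>|\<sigma>. poly ([:0, 1:] * \<phi> n) \<zeta>) - (LINT \<zeta>|\<sigma>. poly (smult (cnj (\<alpha> n)) (star (\<phi> n))) \<zeta>)"
    by (intro Bochner_Integration.integral_diff integrable_poly \<sigma>)
  finally show ?thesis by simp
qed

text \<open>Integrating the reversed recurrence and inserting \<open>integral_shift\<close> yields
  the factor \<open>1 - |\<alpha> n|^2\<close> at each step.\<close>

lemma integral_star: "(LINT \<zeta>|\<sigma>. poly (star (\<phi> n)) \<zeta>) = of_real (szego_weight \<alpha> n)"
proof (induction n)
  case 0
  then show ?case by (simp add: prob_space)
next
  case (Suc n)
  have "(LINT \<zeta>|\<sigma>. poly (star (\<phi> (Suc n))) \<zeta>) =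
      (LINT \<zeta>|\<sigma>. poly (star (\<phi> n)) \<zeta> - poly (smult (\<alpha> n) ([:0, 1:] * \<phi> n)) \<zeta>)"
    by (rule lint_cong_circle[OF \<sigma>]) (measurable, subst poly_star_szego_Suc, auto)
  also have "\<dots> = (LINT \<zeta>|\<sigma>. poly (star (\<phi> n)) \<zeta>) - (LINT \<zeta>|\<sigma>. poly (smult (\<alpha> n) ([:0, 1:] * \<phi> n)) \<zeta>)"
    by (intro Bochner_Integration.integral_diff integrable_poly \<sigma>)
  also have "(LINT \<zeta>|\<sigma>. poly (smult (\<alpha> n) ([:0, 1:] * \<phi> n)) \<zeta>) = (LINT \<zeta>|\<sigma>. \<alpha> n * (\<zeta> * poly (\<phi> n) \<zeta>))"
    by (simp add: algebra_simps)
  also have "\<dots> = \<alpha> n * (LINT \<zeta>|\<sigma>. \<zeta> * poly (\<phi> n) \<zeta>)"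
    by (rule integral_mult_right_zero)
  also have "(LINT \<zeta>|\<sigma>. poly (star (\<phi> n)) \<zeta>) - \<dots> = of_real (szego_weight \<alpha> n) * (1 - \<alpha> n * cnj (\<alpha> n))"
    unfolding integral_shift Suc by (simp add: algebra_simps)
  finally show ?case by (simp add: szego_weight_Suc complex_norm_power2)
qed

text \<open>On the circle the integrand with \<open>j = n\<close> is the reversed polynomial; for
  smaller \<open>j\<close> orthogonality applies.\<close>

lemma integral_monom_cnj:
  assumes "j \<le> n"
  shows "(LINT \<zeta>|\<sigma>. \<zeta> ^ j * cnj (poly (\<phi> n) \<zeta>)) = (if j = n then of_real (szego_weight \<alpha> n) else 0)"
proof (cases "j = n")
  case True
  have "(LINT \<zeta>|\<sigma>. \<zeta> ^ n * cnj (poly (\<phi> n) \<zeta>)) = (LINT \<zeta>|\<sigma>. poly (star (\<phi> n)) \<zeta>)"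
    by (rule lint_cong_circle[OF \<sigma>]) (auto simp: poly_star_circle)
  then show ?thesis using True by (simp add: integral_star)
next
  case False
  then show ?thesis
    using assms orth[of "monom 1 j" n] by (simp add: poly_monom degree_monom_eq)
qed

text \<open>Expanding one factor in powers of \<open>\<zeta>\<close> leaves only the leading term,
  whose coefficient is 1.\<close>

lemma norm_square_integral: "(LINT \<zeta>|\<sigma>. (norm (poly (\<phi> n) \<zeta>))\<^sup>2) = szego_weight \<alpha> n"
proof -
  have "complex_of_real (LINT \<zeta>|\<sigma>. (norm (poly (\<phi> n) \<zeta>))\<^sup>2) = (LINT \<zeta>|\<sigma>. poly (\<phi> n) \<zeta> * cnj (poly (\<phi> n) \<zeta>))"
    by (simp add: complex_norm_power2 flip: integral_complex_of_real)
  also have "\<dots> = (LINT \<zeta>|\<sigma>. (\<Sum>j\<le>n. coeff (\<phi> n) j * (\<zeta> ^ j * cnj (poly (\<phi> n) \<zeta>))))"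
    by (subst poly_altdef) (simp add: sum_distrib_right mult.assoc)
  also have "\<dots> = (\<Sum>j\<le>n. coeff (\<phi> n) j * (LINT \<zeta>|\<sigma>. \<zeta> ^ j * cnj (poly (\<phi> n) \<zeta>)))"
    using integrable_poly_cnj[OF \<sigma>, of "monom 1 _" "\<phi> n"]
    by (subst Bochner_Integration.integral_sum) (auto simp: poly_monom)
  also have "\<dots> = (\<Sum>j\<le>n. if j = n then coeff (\<phi> n) n * of_real (szego_weight \<alpha> n) else 0)"
    by (intro sum.cong) (auto simp: integral_monom_cnj)
  also have "\<dots> = of_real (szego_weight \<alpha> n)" by simp
  finally show ?thesis by (simp only: of_real_eq_iff)
qed

text \<open>Cauchy-Schwarz against the constant 1, in the form that a variance is
  nonnegative.\<close>

lemma integral_norm_le: "(LINT \<zeta>|\<sigma>. norm (poly (\<phi> n) \<zeta>)) \<le> sqrt (szego_weight \<alpha> n)"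
proof (rule real_le_rsqrt)
  have 1: "integrable \<sigma> (\<lambda>\<zeta>. norm (poly (\<phi> n) \<zeta>))"
    by (intro integrable_norm integrable_poly \<sigma>)
  have 2: "integrable \<sigma> (\<lambda>\<zeta>. (norm (poly (\<phi> n) \<zeta>))\<^sup>2)"
    by (rule integrable_on_circle[OF \<sigma>]) (auto intro!: continuous_intros)
  show "(LINT \<zeta>|\<sigma>. norm (poly (\<phi> n) \<zeta>))\<^sup>2 \<le> szego_weight \<alpha> n"
    using variance_eq[OF 1 2] variance_positive[of "\<lambda>\<zeta>. norm (poly (\<phi> n) \<zeta>)"]
    by (simp add: norm_square_integral)
qed

section \<open>Caratheodory function and remainder estimate\<close>

definition carath :: "complex \<Rightarrow> complex" where
  "carath z = (LINT \<zeta>|\<sigma>. (\<zeta> + z) / (\<zeta> - z))"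

lemma integrable_cauchy:
  assumes "norm z < 1"
  shows "integrable \<sigma> (\<lambda>\<zeta>. 2 * \<zeta> / (\<zeta> - z) * poly p \<zeta>)"
proof -
  have "integrable \<sigma> (\<lambda>\<zeta>. (2 * \<zeta> * poly p \<zeta>) / (\<zeta> - z))"
    by (rule integrable_circle_kernel[OF \<sigma> assms]) (intro continuous_intros)
  then show ?thesis by (simp only: times_divide_eq_left)
qed

text \<open>With the kernel \<open>2\<zeta> / (\<zeta> - z)\<close>, which is one plus the Caratheodory kernel, the
  identities hold from \<open>n = 0\<close> on, and the induction step only uses \<open>\<integral> \<phi>\<^bsub>n+1\<^esub> d\<sigma> = 0\<close>.\<close>

lemma functions_of_second_kind:
  assumes z: "z \<noteq> 0" "norm z < 1"
  shows "poly (\<phi> n) z * carath z + poly (second_kind_poly \<alpha> n) z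
           = (LINT \<zeta>|\<sigma>. 2 * \<zeta> / (\<zeta> - z) * poly (\<phi> n) \<zeta>) \<and>
         poly (star (\<phi> n)) z * carath z - poly (star (second_kind_poly \<alpha> n)) z
           = (LINT \<zeta>|\<sigma>. 2 * \<zeta> / (\<zeta> - z) * poly (star (\<phi> n)) \<zeta>) - 2 * of_real (szego_weight \<alpha> n)"
proof (induction n)
  case 0
  have "(LINT \<zeta>|\<sigma>. 2 * \<zeta> / (\<zeta> - z)) = (LINT \<zeta>|\<sigma>. (\<zeta> + z) / (\<zeta> - z) + 1)"
  proof (rule lint_cong_circle[OF \<sigma>])
    fix \<zeta> :: complex assume "norm \<zeta> = 1"
    then have "\<zeta> - z \<noteq> 0" using z by auto
    then show "2 * \<zeta> / (\<zeta> - z) = (\<zeta> + z) / (\<zeta> - z) + 1"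
      by (simp add: divide_simps)
  qed measurable
  also have "\<dots> = carath z + (LINT \<zeta>|\<sigma>. 1)"
    unfolding carath_def
    by (intro Bochner_Integration.integral_add integrable_circle_kernel[OF \<sigma> z(2)] continuous_intros) simp
  finally show ?case by (simp add: second_kind_poly_def prob_space)
next
  case (Suc n)
  let ?K = "\<lambda>\<zeta>. 2 * \<zeta> / (\<zeta> - z)"
  let ?I = "LINT \<zeta>|\<sigma>. ?K \<zeta> * poly (\<phi> n) \<zeta>" and ?Is = "LINT \<zeta>|\<sigma>. ?K \<zeta> * poly (star (\<phi> n)) \<zeta>"
  let ?P = "of_real (szego_weight \<alpha> n) :: complex"
  note int = integrable_cauchy[OF z(2)]
  \<comment> \<open>Writing \<open>\<zeta> = z + (\<zeta> - z)\<close> cancels the denominator in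
    the second summand, which \<open>integral_shift\<close> then evaluates.\<close>
  have shift: "(LINT \<zeta>|\<sigma>. ?K \<zeta> * poly ([:0, 1:] * \<phi> n) \<zeta>) = z * ?I + 2 * (cnj (\<alpha> n) * ?P)"
  proof -
    have "(LINT \<zeta>|\<sigma>. ?K \<zeta> * poly ([:0, 1:] * \<phi> n) \<zeta>)
        = (LINT \<zeta>|\<sigma>. z * (?K \<zeta> * poly (\<phi> n) \<zeta>) + 2 * poly ([:0, 1:] * \<phi> n) \<zeta>)"
    proof (rule lint_cong_circle[OF \<sigma>])
      fix \<zeta> :: complex assume "norm \<zeta> = 1"
      then have "\<zeta> - z \<noteq> 0" using z by auto
      then show "?K \<zeta> * poly ([:0, 1:] * \<phi> n) \<zeta> = z * (?K \<zeta> * poly (\<phi> n) \<zeta>) + 2 * poly ([:0, 1:] * \<phi> n) \<zeta>"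
        by (simp add: divide_simps) (simp add: algebra_simps)
    qed measurable
    also have "\<dots> = z * ?I + 2 * (LINT \<zeta>|\<sigma>. poly ([:0, 1:] * \<phi> n) \<zeta>)"
      unfolding integral_mult_right_zero[symmetric]
      by (intro Bochner_Integration.integral_add integrable_mult_right int integrable_poly \<sigma>)
    finally show ?thesis by (simp add: integral_shift integral_star)
  qed
  have A: "(LINT \<zeta>|\<sigma>. ?K \<zeta> * poly (\<phi> (Suc n)) \<zeta>) = z * ?I + 2 * (cnj (\<alpha> n) * ?P) - cnj (\<alpha> n) * ?Is"
  proof -
    have "(LINT \<zeta>|\<sigma>. ?K \<zeta> * poly (\<phi> (Suc n)) \<zeta>)
       = (LINT \<zeta>|\<sigma>. ?K \<zeta> * poly ([:0, 1:] * \<phi> n) \<zeta> - cnj (\<alpha> n) * (?K \<zeta> * poly (star (\<phi> n)) \<zeta>))"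
      by (simp add: algebra_simps)
    also have "\<dots> = (LINT \<zeta>|\<sigma>. ?K \<zeta> * poly ([:0, 1:] * \<phi> n) \<zeta>) - cnj (\<alpha> n) * ?Is"
      unfolding integral_mult_right_zero[symmetric]
      by (intro Bochner_Integration.integral_diff integrable_mult_right int)
    finally show ?thesis by (simp only: shift)
  qed
  have B: "(LINT \<zeta>|\<sigma>. ?K \<zeta> * poly (star (\<phi> (Suc n))) \<zeta>) = ?Is - \<alpha> n * (z * ?I + 2 * (cnj (\<alpha> n) * ?P))"
  proof -
    have "(LINT \<zeta>|\<sigma>. ?K \<zeta> * poly (star (\<phi> (Suc n))) \<zeta>)
       = (LINT \<zeta>|\<sigma>. ?K \<zeta> * poly (star (\<phi> n)) \<zeta> - \<alpha> n * (?K \<zeta> * poly ([:0, 1:] * \<phi> n) \<zeta>))"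
      by (rule lint_cong_circle[OF \<sigma>], measurable, subst poly_star_szego_Suc) (auto simp: algebra_simps)
    also have "\<dots> = ?Is - \<alpha> n * (LINT \<zeta>|\<sigma>. ?K \<zeta> * poly ([:0, 1:] * \<phi> n) \<zeta>)"
      unfolding integral_mult_right_zero[symmetric]
      by (intro Bochner_Integration.integral_diff integrable_mult_right int)
    finally show ?thesis by (simp only: shift)
  qed
  have P: "complex_of_real (szego_weight \<alpha> (Suc n)) = ?P * (1 - \<alpha> n * cnj (\<alpha> n))"
    by (simp add: szego_weight_Suc complex_norm_power2)
  from Suc[THEN conjunct1, symmetric] have C: "?I = poly (\<phi> n) z * carath z + poly (second_kind_poly \<alpha> n) z" .
  from Suc[THEN conjunct2] have D: "?Is = poly (star (\<phi> n)) z * carath z - poly (star (second_kind_poly \<alpha> n)) z + 2 * ?P"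
    by (simp add: algebra_simps)
  show ?case
    unfolding A B P C D
    unfolding second_kind_poly_def poly_szego_Suc poly_star_szego_Suc[OF z(1)]
    by (simp add: algebra_simps)
qed

text \<open>The geometric sum splits \<open>\<zeta> ^ Suc n / (\<zeta> - z)\<close> into
  \<open>z ^ Suc n / (\<zeta> - z)\<close> plus a polynomial of degree n in \<open>\<zeta>\<close>.
  Orthogonality kills all of that polynomial but its top term, and
  \<open>|\<zeta> - z| \<ge> 1 - |z|\<close> bounds what is left.\<close>

lemma star_remainder_bound:
  assumes z: "z \<noteq> 0" "norm z < 1"
  shows "norm (poly (star (\<phi> n)) z * carath z - poly (star (second_kind_poly \<alpha> n)) z)
         \<le> 2 / (1 - norm z) * norm z ^ n * sqrt (szego_weight \<alpha> n)"
proof -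
  let ?J = "LINT \<zeta>|\<sigma>. cnj (poly (\<phi> n) \<zeta>) / (\<zeta> - z)"
  have i: "integrable \<sigma> (\<lambda>\<zeta>. cnj (poly (\<phi> n) \<zeta>) / (\<zeta> - z))"
    by (rule integrable_circle_kernel[OF \<sigma> z(2)]) (intro continuous_intros)
  have im: "integrable \<sigma> (\<lambda>\<zeta>. \<zeta> ^ j * cnj (poly (\<phi> n) \<zeta>))" for j
    by (rule integrable_on_circle[OF \<sigma>]) (auto intro!: continuous_intros)
  have "(LINT \<zeta>|\<sigma>. 2 * \<zeta> / (\<zeta> - z) * poly (star (\<phi> n)) \<zeta>) =
      (LINT \<zeta>|\<sigma>. 2 * z ^ Suc n * (cnj (poly (\<phi> n) \<zeta>) / (\<zeta> - z))
        + (\<Sum>j\<le>n. 2 * z ^ (n - j) * (\<zeta> ^ j * cnj (poly (\<phi> n) \<zeta>))))"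
  proof (rule lint_cong_circle[OF \<sigma>])
    fix \<zeta> :: complex assume \<zeta>: "norm \<zeta> = 1"
    then have d: "\<zeta> - z \<noteq> 0" using z by auto
    have "\<zeta> ^ Suc n - z ^ Suc n = (\<zeta> - z) * (\<Sum>j\<le>n. \<zeta> ^ j * z ^ (n - j))"
      using diff_power_eq_sum[of \<zeta> n z] by (simp only: lessThan_Suc_atMost)
    then have "\<zeta> ^ Suc n / (\<zeta> - z) = z ^ Suc n / (\<zeta> - z) + (\<Sum>j\<le>n. \<zeta> ^ j * z ^ (n - j))"
      using d by (simp add: field_simps)
    moreover have "2 * \<zeta> / (\<zeta> - z) * poly (star (\<phi> n)) \<zeta>
        = 2 * (\<zeta> ^ Suc n / (\<zeta> - z)) * cnj (poly (\<phi> n) \<zeta>)"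
      using \<zeta> by (simp add: poly_star_circle)
    ultimately show "2 * \<zeta> / (\<zeta> - z) * poly (star (\<phi> n)) \<zeta> =
        2 * z ^ Suc n * (cnj (poly (\<phi> n) \<zeta>) / (\<zeta> - z))
        + (\<Sum>j\<le>n. 2 * z ^ (n - j) * (\<zeta> ^ j * cnj (poly (\<phi> n) \<zeta>)))"
      by (simp add: algebra_simps sum_distrib_left sum_distrib_right)
  qed measurable
  also have "\<dots> = 2 * z ^ Suc n * ?J
      + (\<Sum>j\<le>n. 2 * z ^ (n - j) * (LINT \<zeta>|\<sigma>. \<zeta> ^ j * cnj (poly (\<phi> n) \<zeta>)))"
  proof -
    have "integrable \<sigma> (\<lambda>\<zeta>. 2 * z ^ Suc n * (cnj (poly (\<phi> n) \<zeta>) / (\<zeta> - z)))"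
      by (intro integrable_mult_right i)
    moreover have s: "integrable \<sigma> (\<lambda>\<zeta>. 2 * z ^ (n - j) * (\<zeta> ^ j * cnj (poly (\<phi> n) \<zeta>)))" for j
      by (intro integrable_mult_right im)
    moreover from s have "integrable \<sigma> (\<lambda>\<zeta>. \<Sum>j\<le>n. 2 * z ^ (n - j) * (\<zeta> ^ j * cnj (poly (\<phi> n) \<zeta>)))"
      by (rule Bochner_Integration.integrable_sum)
    ultimately show ?thesis
      by (simp only: Bochner_Integration.integral_add Bochner_Integration.integral_sum integral_mult_right_zero)
  qed
  \<comment> \<open>The surviving term \<open>j = n\<close> cancels the correction
    \<open>- 2 * of_real (szego_weight \<alpha> n)\<close> from
    \<open>functions_of_second_kind\<close>.\<close>
  also have "(\<Sum>j\<le>n. 2 * z ^ (n - j) * (LINT \<zeta>|\<sigma>. \<zeta> ^ j * cnj (poly (\<phi> n) \<zeta>)))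
      = (\<Sum>j\<le>n. if j = n then 2 * complex_of_real (szego_weight \<alpha> n) else 0)"
    by (intro sum.cong) (auto simp: integral_monom_cnj)
  also have "\<dots> = 2 * of_real (szego_weight \<alpha> n)" by simp
  finally have eq: "poly (star (\<phi> n)) z * carath z - poly (star (second_kind_poly \<alpha> n)) z = 2 * z ^ Suc n * ?J"
    using functions_of_second_kind[OF z, of n] by simp
  have "norm ?J \<le> (LINT \<zeta>|\<sigma>. norm (cnj (poly (\<phi> n) \<zeta>) / (\<zeta> - z)))"
    by (rule integral_norm_bound)
  also have "\<dots> \<le> (LINT \<zeta>|\<sigma>. norm (poly (\<phi> n) \<zeta>) / (1 - norm z))"
  proof (rule integral_mono_AE)
    show "AE \<zeta> in \<sigma>. norm (cnj (poly (\<phi> n) \<zeta>) / (\<zeta> - z)) \<le> norm (poly (\<phi> n) \<zeta>) / (1 - norm z)"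
      using prob_onD(3)[OF \<sigma>]
    proof eventually_elim
      case (elim \<zeta>)
      then have "1 - norm z \<le> norm (\<zeta> - z)"
        using norm_triangle_ineq2[of \<zeta> z] by simp
      then show ?case using z by (auto simp: norm_divide intro!: divide_left_mono mult_pos_pos)
    qed
    show "integrable \<sigma> (\<lambda>\<zeta>. norm (cnj (poly (\<phi> n) \<zeta>) / (\<zeta> - z)))" using i by (rule integrable_norm)
    show "integrable \<sigma> (\<lambda>\<zeta>. norm (poly (\<phi> n) \<zeta>) / (1 - norm z))"
      by (intro integrable_divide integrable_norm integrable_poly \<sigma>)
  qed
  also have "\<dots> \<le> sqrt (szego_weight \<alpha> n) / (1 - norm z)"
    using integral_norm_le[of n] z by (simp add: divide_right_mono)
  finally have J: "norm ?J \<le> sqrt (szego_weight \<alpha> n) / (1 - norm z)" .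
  have "norm (2 * z ^ Suc n * ?J) = 2 * norm z ^ Suc n * norm ?J" by (simp add: norm_mult norm_power)
  \<comment> \<open>One of the n + 1 factors \<open>norm z\<close> is given away to simplify the
    bound.\<close>
  also have "\<dots> \<le> 2 * norm z ^ n * (sqrt (szego_weight \<alpha> n) / (1 - norm z))"
    using z J by (intro mult_mono power_decreasing) auto
  finally show ?thesis using eq by (simp add: field_simps)
qed

end

section \<open>Existence and uniqueness of the orthogonal polynomials\<close>

lemma nontrivial_poly_norm_pos:
  fixes p :: "complex poly"
  assumes \<sigma>: "prob_on (sphere 0 1) \<sigma>" and nt: "nontrivial_measure \<sigma>" and "p \<noteq> 0"
  shows "(LINT \<zeta>|\<sigma>. (norm (poly p \<zeta>))\<^sup>2) > 0"
proof -
  have i: "integrable \<sigma> (\<lambda>\<zeta>. (norm (poly p \<zeta>))\<^sup>2)"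
    by (rule integrable_on_circle[OF \<sigma>]) (auto intro!: continuous_intros)
  have "(LINT \<zeta>|\<sigma>. (norm (poly p \<zeta>))\<^sup>2) \<noteq> 0"
  proof
    assume "(LINT \<zeta>|\<sigma>. (norm (poly p \<zeta>))\<^sup>2) = 0"
    then have "AE \<zeta> in \<sigma>. (norm (poly p \<zeta>))\<^sup>2 = 0"
      using integral_nonneg_eq_0_iff_AE[OF i] by simp
    \<comment> \<open>A vanishing norm would make the finite zero set of \<open>p\<close> carry
      \<open>\<sigma>\<close>.\<close>
    then have "AE \<zeta> in \<sigma>. \<zeta> \<in> {\<zeta>. poly p \<zeta> = 0}" by simp
    then show False using nt poly_roots_finite[OF \<open>p \<noteq> 0\<close>] by (auto simp: nontrivial_measure_def)
  qed
  moreover have "(LINT \<zeta>|\<sigma>. (norm (poly p \<zeta>))\<^sup>2) \<ge> 0" by (intro integral_nonneg_AE) simp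
  ultimately show ?thesis by linarith
qed

lemma nontrivial_poly_eq_0:
  assumes \<sigma>: "prob_on (sphere 0 1) \<sigma>" and nt: "nontrivial_measure \<sigma>"
    and "(LINT \<zeta>|\<sigma>. poly p \<zeta> * cnj (poly p \<zeta>)) = 0"
  shows "p = 0"
proof (rule ccontr)
  assume "p \<noteq> 0"
  have "complex_of_real (LINT \<zeta>|\<sigma>. (norm (poly p \<zeta>))\<^sup>2) = 0"
    using assms(3) by (simp add: complex_norm_power2 flip: integral_complex_of_real)
  then show False using nontrivial_poly_norm_pos[OF \<sigma> nt \<open>p \<noteq> 0\<close>] by (simp del: integral_complex_of_real)
qed

text \<open>The difference of two candidates has degree below n, so it is orthogonal to both of them
  and hence to itself. This makes the \<open>THE\<close> in \<open>verblunsky\<close>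
  meaningful.\<close>

lemma monic_OPs_unique:
  assumes \<sigma>: "prob_on (sphere 0 1) \<sigma>" and nt: "nontrivial_measure \<sigma>"
    and 1: "monic_OPs \<sigma> \<Phi>" and 2: "monic_OPs \<sigma> \<Psi>"
  shows "\<Phi> = \<Psi>"
proof
  fix n
  let ?q = "\<Phi> n - \<Psi> n"
  have d: "degree (\<Phi> n) = n" "coeff (\<Phi> n) n = 1" "degree (\<Psi> n) = n" "coeff (\<Psi> n) n = 1"
    using monic_OPsD[OF 1, of n] monic_OPsD[OF 2, of n] by auto
  show "\<Phi> n = \<Psi> n"
  proof (cases "?q = 0")
    case False
    have "degree ?q < n"
    proof (rule ccontr)
      assume n: "\<not> degree ?q < n"
      have "degree ?q \<le> n" using d by (intro degree_diff_le) auto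
      then have "degree ?q = n" using n by simp
      moreover have "coeff ?q n = 0" using d by simp
      ultimately show False using False by (metis leading_coeff_0_iff)
    qed
    then have "(LINT \<zeta>|\<sigma>. poly ?q \<zeta> * cnj (poly (\<Phi> n) \<zeta>)) - (LINT \<zeta>|\<sigma>. poly ?q \<zeta> * cnj (poly (\<Psi> n) \<zeta>)) = 0"
      by (simp only: monic_OPs_orthogonal[OF \<sigma> 1] monic_OPs_orthogonal[OF \<sigma> 2] diff_zero)
    also have "(LINT \<zeta>|\<sigma>. poly ?q \<zeta> * cnj (poly (\<Phi> n) \<zeta>)) - (LINT \<zeta>|\<sigma>. poly ?q \<zeta> * cnj (poly (\<Psi> n) \<zeta>))
        = (LINT \<zeta>|\<sigma>. poly ?q \<zeta> * cnj (poly (\<Phi> n) \<zeta>) - poly ?q \<zeta> * cnj (poly (\<Psi> n) \<zeta>))"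
      by (intro Bochner_Integration.integral_diff[symmetric] integrable_poly_cnj \<sigma>)
    also have "\<dots> = (LINT \<zeta>|\<sigma>. poly ?q \<zeta> * cnj (poly ?q \<zeta>))" by (simp add: algebra_simps)
    finally have "?q = 0" by (rule nontrivial_poly_eq_0[OF \<sigma> nt])
    then show ?thesis by simp
  qed simp
qed

text \<open>Multiplication by \<open>\<zeta>\<close> preserves the inner product, because
  \<open>|\<zeta>| = 1\<close>.\<close>

lemma lint_power_shift:
  assumes \<sigma>: "prob_on (sphere 0 1) \<sigma>"
  shows "(LINT \<zeta>|\<sigma>. cnj (\<zeta> ^ Suc j) * poly ([:0, 1:] * p) \<zeta>) = (LINT \<zeta>|\<sigma>. cnj (\<zeta> ^ j) * poly p \<zeta>)"
proof (rule lint_cong_circle[OF \<sigma>])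
  fix \<zeta> :: complex assume "norm \<zeta> = 1"
  then have "cnj \<zeta> * \<zeta> = 1" using complex_norm_square[of \<zeta>] by (simp add: mult.commute)
  then have "cnj (\<zeta> ^ Suc j) * poly ([:0, 1:] * p) \<zeta> = (cnj \<zeta> * \<zeta>) * (cnj (\<zeta> ^ j) * poly p \<zeta>)"
    by (simp add: algebra_simps)
  then show "cnj (\<zeta> ^ Suc j) * poly ([:0, 1:] * p) \<zeta> = cnj (\<zeta> ^ j) * poly p \<zeta>"
    using \<open>cnj \<zeta> * \<zeta> = 1\<close> by simp
qed measurable

text \<open>Reversal is antiunitary on the circle: it exchanges the powers \<open>j\<close> and
  \<open>degree p - j\<close> and conjugates the inner product.\<close>

lemma lint_power_star:
  assumes \<sigma>: "prob_on (sphere 0 1) \<sigma>" and "j \<le> degree p"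
  shows "(LINT \<zeta>|\<sigma>. cnj (\<zeta> ^ j) * poly (star p) \<zeta>) = cnj (LINT \<zeta>|\<sigma>. cnj (\<zeta> ^ (degree p - j)) * poly p \<zeta>)"
proof -
  have "(LINT \<zeta>|\<sigma>. cnj (\<zeta> ^ j) * poly (star p) \<zeta>) = (LINT \<zeta>|\<sigma>. \<zeta> ^ (degree p - j) * cnj (poly p \<zeta>))"
  proof (rule lint_cong_circle[OF \<sigma>])
    fix \<zeta> :: complex assume \<zeta>: "norm \<zeta> = 1"
    then have 1: "cnj \<zeta> * \<zeta> = 1" using complex_norm_square[of \<zeta>] by (simp add: mult.commute)
    have "\<zeta> ^ degree p = \<zeta> ^ j * \<zeta> ^ (degree p - j)" using assms(2) by (simp flip: power_add)
    then have "cnj (\<zeta> ^ j) * poly (star p) \<zeta> = (cnj \<zeta> * \<zeta>) ^ j * (\<zeta> ^ (degree p - j) * cnj (poly p \<zeta>))"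
      using \<zeta> by (simp add: poly_star_circle power_mult_distrib)
    then show "cnj (\<zeta> ^ j) * poly (star p) \<zeta> = \<zeta> ^ (degree p - j) * cnj (poly p \<zeta>)"
      using 1 by simp
  qed measurable
  also have "\<dots> = cnj (LINT \<zeta>|\<sigma>. cnj (\<zeta> ^ (degree p - j)) * poly p \<zeta>)"
    by (subst Bochner_Integration.integral_cnj[symmetric]) simp
  finally show ?thesis .
qed

lemma lint_poly_cnj_expand:
  assumes \<sigma>: "prob_on (sphere 0 1) \<sigma>"
  shows "(LINT \<zeta>|\<sigma>. poly p \<zeta> * cnj (poly q \<zeta>)) =
    (\<Sum>j\<le>degree q. cnj (coeff q j) * (LINT \<zeta>|\<sigma>. cnj (\<zeta> ^ j) * poly p \<zeta>))"
proof -
  have i: "integrable \<sigma> (\<lambda>\<zeta>. cnj (\<zeta> ^ j) * poly p \<zeta>)" for j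
    by (rule integrable_on_circle[OF \<sigma>]) (auto intro!: continuous_intros)
  have "(LINT \<zeta>|\<sigma>. poly p \<zeta> * cnj (poly q \<zeta>)) =
     (LINT \<zeta>|\<sigma>. (\<Sum>j\<le>degree q. cnj (coeff q j) * (cnj (\<zeta> ^ j) * poly p \<zeta>)))"
    by (subst (2) poly_altdef) (simp add: sum_distrib_left algebra_simps)
  also have "\<dots> = (\<Sum>j\<le>degree q. cnj (coeff q j) * (LINT \<zeta>|\<sigma>. cnj (\<zeta> ^ j) * poly p \<zeta>))"
    using i by (subst Bochner_Integration.integral_sum) auto
  finally show ?thesis .
qed

text \<open>Instead of Gram-Schmidt, the recurrence itself is run with coefficients that make each
  new polynomial orthogonal to 1. Orthogonality to the higher powers is inherited through the shift
  and the reversal.\<close>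

lemma monic_OPs_exists_szego:
  assumes \<sigma>: "prob_on (sphere 0 1) \<sigma>" and nt: "nontrivial_measure \<sigma>"
  shows "\<exists>\<alpha>. monic_OPs \<sigma> (szego_poly \<alpha>)"
proof -
  \<comment> \<open>\<open>c p\<close> is the number for which \<open>\<zeta> * p\<close> minus
    \<open>c p\<close> times the reversed \<open>p\<close> has integral 0. It depends on the
    polynomial reached so far, so the sequence is built first and \<open>\<alpha>\<close> read off
    from it.\<close>
  define c where "c p = (LINT \<zeta>|\<sigma>. \<zeta> * poly p \<zeta>) / (LINT \<zeta>|\<sigma>. poly (star p) \<zeta>)" for p
  define \<Phi> where "\<Phi> = rec_nat 1 (\<lambda>_ p. [:0, 1:] * p - smult (c p) (star p))"
  define \<alpha> where "\<alpha> n = cnj (c (\<Phi> n))" for n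
  have \<Phi>: "szego_poly \<alpha> n = \<Phi> n" for n
    by (induction n) (auto simp: \<Phi>_def \<alpha>_def)
  have \<alpha>: "cnj (\<alpha> n) = c (szego_poly \<alpha> n)" for n by (simp add: \<Phi> \<alpha>_def)
  let ?\<phi> = "szego_poly \<alpha>"
  have i: "integrable \<sigma> (\<lambda>\<zeta>. cnj (\<zeta> ^ j) * poly p \<zeta>)" for j p
    by (rule integrable_on_circle[OF \<sigma>]) (auto intro!: continuous_intros)
  have orth: "\<forall>j<n. (LINT \<zeta>|\<sigma>. cnj (\<zeta> ^ j) * poly (?\<phi> n) \<zeta>) = 0" for n
  proof (induction n)
    case (Suc n)
    have split: "(LINT \<zeta>|\<sigma>. cnj (\<zeta> ^ j) * poly (?\<phi> (Suc n)) \<zeta>) =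
        (LINT \<zeta>|\<sigma>. cnj (\<zeta> ^ j) * poly ([:0, 1:] * ?\<phi> n) \<zeta>)
        - cnj (\<alpha> n) * (LINT \<zeta>|\<sigma>. cnj (\<zeta> ^ j) * poly (star (?\<phi> n)) \<zeta>)" for j
    proof -
      have "(LINT \<zeta>|\<sigma>. cnj (\<zeta> ^ j) * poly (?\<phi> (Suc n)) \<zeta>) =
        (LINT \<zeta>|\<sigma>. cnj (\<zeta> ^ j) * poly ([:0, 1:] * ?\<phi> n) \<zeta> -
          cnj (\<alpha> n) * (cnj (\<zeta> ^ j) * poly (star (?\<phi> n)) \<zeta>))"
        by (simp add: algebra_simps)
      also have "\<dots> = (LINT \<zeta>|\<sigma>. cnj (\<zeta> ^ j) * poly ([:0, 1:] * ?\<phi> n) \<zeta>)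
        - cnj (\<alpha> n) * (LINT \<zeta>|\<sigma>. cnj (\<zeta> ^ j) * poly (star (?\<phi> n)) \<zeta>)"
        by (subst Bochner_Integration.integral_diff) (intro integrable_mult_right i | simp)+
      finally show ?thesis .
    qed
    have st: "(LINT \<zeta>|\<sigma>. cnj (\<zeta> ^ j) * poly (star (?\<phi> n)) \<zeta>)
        = cnj (LINT \<zeta>|\<sigma>. cnj (\<zeta> ^ (n - j)) * poly (?\<phi> n) \<zeta>)" if "j \<le> n" for j
      using lint_power_star[OF \<sigma>, of j "?\<phi> n"] that by simp
    show ?case
    proof (intro allI impI)
      fix j assume j: "j < Suc n"
      show "(LINT \<zeta>|\<sigma>. cnj (\<zeta> ^ j) * poly (?\<phi> (Suc n)) \<zeta>) = 0"
      proof (cases j)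
        case 0
        \<comment> \<open>The denominator of \<open>c\<close> is nonzero: the squared norm of
          \<open>?\<phi> n\<close> reduces to its n-th moment, which is the conjugate of the
          integral of the reversed polynomial.\<close>
        have "(LINT \<zeta>|\<sigma>. poly (?\<phi> n) \<zeta> * cnj (poly (?\<phi> n) \<zeta>)) =
           (\<Sum>j\<le>n. if j = n then (LINT \<zeta>|\<sigma>. cnj (\<zeta> ^ n) * poly (?\<phi> n) \<zeta>) else 0)"
          using Suc unfolding lint_poly_cnj_expand[OF \<sigma>] by (intro sum.cong) auto
        also have "\<dots> = cnj (LINT \<zeta>|\<sigma>. poly (star (?\<phi> n)) \<zeta>)"
          using st[of 0] by simp
        finally have "(LINT \<zeta>|\<sigma>. poly (star (?\<phi> n)) \<zeta>) \<noteq> 0"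
          using nontrivial_poly_eq_0[OF \<sigma> nt, of "?\<phi> n"]
          by (metis complex_cnj_zero coeff_szego coeff_0 zero_neq_one)
        then show ?thesis unfolding split using 0 by (simp add: \<alpha> c_def)
      next
        case (Suc m)
        \<comment> \<open>Both terms of \<open>split\<close> vanish: the shift leads to the power
          \<open>m < n\<close>, the reversal to \<open>n - j\<close>, which is below n because
          \<open>j\<close> is positive.\<close>
        then have "(LINT \<zeta>|\<sigma>. cnj (\<zeta> ^ j) * poly ([:0, 1:] * ?\<phi> n) \<zeta>) = 0"
          using j Suc.IH lint_power_shift[OF \<sigma>, of m "?\<phi> n"] by simp
        moreover have "(LINT \<zeta>|\<sigma>. cnj (\<zeta> ^ j) * poly (star (?\<phi> n)) \<zeta>) = 0"
          using j Suc st[of j] Suc.IH by simp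
        ultimately show ?thesis unfolding split by simp
      qed
    qed
  qed simp
  have lower: "(LINT \<zeta>|\<sigma>. poly (?\<phi> m) \<zeta> * cnj (poly (?\<phi> n) \<zeta>)) = 0" if "n < m" for m n
    unfolding lint_poly_cnj_expand[OF \<sigma>] using that orth[of m] by (intro sum.neutral) auto
  have "(LINT \<zeta>|\<sigma>. poly (?\<phi> m) \<zeta> * cnj (poly (?\<phi> n) \<zeta>)) = 0" if "m \<noteq> n" for m n
  proof (cases "n < m")
    case False
    have "(LINT \<zeta>|\<sigma>. poly (?\<phi> m) \<zeta> * cnj (poly (?\<phi> n) \<zeta>)) =
        (LINT \<zeta>|\<sigma>. cnj (poly (?\<phi> n) \<zeta> * cnj (poly (?\<phi> m) \<zeta>)))"
      by (simp add: mult.commute)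
    also have "\<dots> = cnj (LINT \<zeta>|\<sigma>. poly (?\<phi> n) \<zeta> * cnj (poly (?\<phi> m) \<zeta>))"
      by (rule Bochner_Integration.integral_cnj)
    finally have "(LINT \<zeta>|\<sigma>. poly (?\<phi> m) \<zeta> * cnj (poly (?\<phi> n) \<zeta>)) =
        cnj (LINT \<zeta>|\<sigma>. poly (?\<phi> n) \<zeta> * cnj (poly (?\<phi> m) \<zeta>))" .
    then show ?thesis using lower[of m n] that False by simp
  qed (rule lower)
  then show ?thesis by (auto simp: monic_OPs_def)
qed

text \<open>Reversed monic polynomials are 1 at the origin, so the recurrence at 0 returns
  \<open>- cnj (\<alpha> n)\<close>, exactly what \<open>verblunsky\<close> reads off.\<close>

lemma monic_OPs_verblunsky:
  assumes \<sigma>: "prob_on (sphere 0 1) \<sigma>" and nt: "nontrivial_measure \<sigma>"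
  shows "monic_OPs \<sigma> (szego_poly (verblunsky \<sigma>))"
proof -
  obtain \<alpha> where \<alpha>: "monic_OPs \<sigma> (szego_poly \<alpha>)"
    using monic_OPs_exists_szego[OF assms] by blast
  have "(THE \<Phi>. monic_OPs \<sigma> \<Phi>) = szego_poly \<alpha>"
    using \<alpha> monic_OPs_unique[OF assms _ \<alpha>] by (intro the_equality)
  then have "verblunsky \<sigma> n = \<alpha> n" for n
    by (simp add: verblunsky_def poly_star_0)
  then have "verblunsky \<sigma> = \<alpha>" ..
  with \<alpha> show ?thesis by simp
qed

section \<open>The Szego transform and the S-function\<close>

lemma Szego_prob_on:
  assumes "prob_on {-1..1} \<nu>"
  shows "prob_on (sphere 0 1) (Szego \<nu>)" "distr (Szego \<nu>) borel cnj = Szego \<nu>"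
    "distr (Szego \<nu>) borel Re = \<nu>"
  using Szego_characterization[OF assms, of "Szego \<nu>"] by auto

text \<open>The real parts of a finite carrier on the circle would form a finite carrier of
  \<open>\<nu>\<close>.\<close>

lemma nontrivial_Szego:
  assumes \<nu>: "prob_on {-1..1} \<nu>" and nt: "nontrivial_measure \<nu>"
  shows "nontrivial_measure (Szego \<nu>)"
  unfolding nontrivial_measure_def
proof
  assume "\<exists>F. finite F \<and> (AE x in Szego \<nu>. x \<in> F)"
  then obtain F where F: "finite F" "AE \<zeta> in Szego \<nu>. \<zeta> \<in> F" by blast
  have "AE \<zeta> in Szego \<nu>. Re \<zeta> \<in> Re ` F" using F(2) by eventually_elim auto
  moreover have "Re \<in> measurable (Szego \<nu>) borel" by (simp cong: measurable_cong_sets)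
  moreover have "Re ` F \<in> sets borel" using F by (intro borel_closed finite_imp_closed) auto
  ultimately have "AE y in distr (Szego \<nu>) borel Re. y \<in> Re ` F"
    by (subst AE_distr_iff) auto
  then have "AE y in \<nu>. y \<in> Re ` F" by (simp only: Szego_prob_on(3)[OF \<nu>])
  then show False using nt finite_imageI[OF F(1)] unfolding nontrivial_measure_def by blast
qed

text \<open>By invariance under conjugation the kernel may be averaged over \<open>\<zeta>\<close>
  and \<open>cnj \<zeta>\<close>. The average depends on \<open>Re \<zeta>\<close> alone, and the
  push-forward under \<open>Re\<close> is \<open>\<nu>\<close>. In the application
  \<open>x - z\<close> is \<open>sqrt_branch x\<close>.\<close>

lemma carath_Szego:
  assumes \<nu>: "prob_on {-1..1} \<nu>" and z: "z \<noteq> 0" "norm z < 1" and x: "2 * x * z = z\<^sup>2 + 1"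
  shows "(LINT \<zeta>|Szego \<nu>. (\<zeta> + z) / (\<zeta> - z)) = (x - z) * S_function \<nu> x"
proof -
  let ?\<sigma> = "Szego \<nu>" and ?K = "\<lambda>\<zeta>. (\<zeta> + z) / (\<zeta> - z)"
  note \<sigma> = Szego_prob_on(1)[OF \<nu>]
  have i: "integrable ?\<sigma> ?K"
    by (rule integrable_circle_kernel[OF \<sigma> z(2)]) (intro continuous_intros)
  have cnj_m: "cnj \<in> borel_measurable ?\<sigma>" by (simp cong: measurable_cong_sets)
  have "integrable (distr ?\<sigma> borel cnj) ?K" using i by (simp only: Szego_prob_on(2)[OF \<nu>])
  then have i': "integrable ?\<sigma> (\<lambda>\<zeta>. ?K (cnj \<zeta>))" by (rule integrable_distr[OF cnj_m])
  have "(LINT \<zeta>|?\<sigma>. ?K \<zeta>) = (LINT \<zeta>|distr ?\<sigma> borel cnj. ?K \<zeta>)"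
    by (simp only: Szego_prob_on(2)[OF \<nu>])
  also have "\<dots> = (LINT \<zeta>|?\<sigma>. ?K (cnj \<zeta>))"
    by (rule integral_distr) (auto cong: measurable_cong_sets)
  finally have "2 * (LINT \<zeta>|?\<sigma>. ?K \<zeta>) = (LINT \<zeta>|?\<sigma>. ?K \<zeta>) + (LINT \<zeta>|?\<sigma>. ?K (cnj \<zeta>))" by simp
  also have "\<dots> = (LINT \<zeta>|?\<sigma>. ?K \<zeta> + ?K (cnj \<zeta>))"
    using i i' by (rule Bochner_Integration.integral_add[symmetric])
  also have "\<dots> = (LINT \<zeta>|?\<sigma>. 2 * (x - z) * (1 / (x - of_real (Re \<zeta>))))"
  proof (rule lint_cong_circle[OF \<sigma>])
    fix \<zeta> :: complex assume \<zeta>: "norm \<zeta> = 1"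
    define y where "y = complex_of_real (Re \<zeta>)"
    have n: "\<zeta> - z \<noteq> 0" "cnj \<zeta> - z \<noteq> 0" using z \<zeta> complex_mod_cnj[of \<zeta>] by auto
    have 1: "\<zeta> * cnj \<zeta> = 1" using \<zeta> complex_norm_square[of \<zeta>] by simp
    have 2: "\<zeta> + cnj \<zeta> = 2 * y" by (simp add: y_def complex_add_cnj)
    have "(\<zeta> - z) * (cnj \<zeta> - z) = \<zeta> * cnj \<zeta> - z * (\<zeta> + cnj \<zeta>) + z\<^sup>2"
      by (simp add: algebra_simps power2_eq_square)
    also have "\<dots> = 2 * z * (x - y)" using x by (simp only: 1 2) (simp add: algebra_simps)
    finally have p: "(\<zeta> - z) * (cnj \<zeta> - z) = 2 * z * (x - y)" .
    then have xy: "x - y \<noteq> 0" using n by auto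
    have "?K \<zeta> + ?K (cnj \<zeta>) = ((\<zeta> + z) * (cnj \<zeta> - z) + (cnj \<zeta> + z) * (\<zeta> - z)) / ((\<zeta> - z) * (cnj \<zeta> - z))"
      using n by (simp add: add_frac_eq)
    also have "(\<zeta> + z) * (cnj \<zeta> - z) + (cnj \<zeta> + z) * (\<zeta> - z) = 2 * (\<zeta> * cnj \<zeta>) - 2 * z\<^sup>2"
      by (simp add: algebra_simps power2_eq_square)
    also have "\<dots> = 2 * z * (2 * (x - z))"
    proof -
      have "2 * z * (2 * (x - z)) = 2 * (2 * x * z) - 4 * z\<^sup>2"
        by (simp add: algebra_simps power2_eq_square)
      then show ?thesis by (simp only: 1 x) simp
    qed
    also have "2 * z * (2 * (x - z)) / ((\<zeta> - z) * (cnj \<zeta> - z)) = 2 * (x - z) * (1 / (x - y))"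
      unfolding p using z xy by (simp add: field_simps)
    finally show "?K \<zeta> + ?K (cnj \<zeta>) = 2 * (x - z) * (1 / (x - of_real (Re \<zeta>)))" by (simp only: y_def)
  qed measurable
  also have "\<dots> = 2 * (x - z) * (LINT \<zeta>|?\<sigma>. 1 / (x - of_real (Re \<zeta>)))" by (simp only: integral_mult_right_zero)
  also have "(LINT \<zeta>|?\<sigma>. 1 / (x - of_real (Re \<zeta>))) = (LINT y|distr ?\<sigma> borel Re. 1 / (x - of_real y))"
    by (rule integral_distr[symmetric]) (auto cong: measurable_cong_sets)
  also have "\<dots> = S_function \<nu> x" by (simp only: Szego_prob_on(3)[OF \<nu>] S_function_def)
  finally show ?thesis by (metis mult.assoc mult_cancel_left zero_neq_numeral)
qed

section \<open>The transformation of the Caratheodory functions\<close>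

theorem theorem8:
  fixes \<mu> \<mu>' :: "real measure" and k :: nat and \<xi> :: "nat \<Rightarrow> real" and x :: complex
  assumes "prob_on {-1..1} \<mu>" and "nontrivial_measure \<mu>"
    and "k \<ge> 1" and "\<And>j. j < k \<Longrightarrow> \<xi> j \<in> {-1<..<1}"
    and "prob_on {-1..1} \<mu>'"
    and "monic_OPs (Szego \<mu>') (anti_associated_poly k (complex_of_real \<circ> \<xi>) (verblunsky (Szego \<mu>)))"
    and "x \<notin> complex_of_real ` {-1..1}"
  shows "lin_frac_eq (sqrt_branch x * S_function \<mu>' x)
           (Upsilon k (complex_of_real \<circ> \<xi>) (x - sqrt_branch x))
           (sqrt_branch x * S_function \<mu> x)"
proof -
  define w where "w = sqrt_branch x"
  define z where "z = x - w"
  define \<alpha> where "\<alpha> = verblunsky (Szego \<mu>)"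
  define \<eta> where "\<eta> = complex_of_real \<circ> \<xi>"
  define \<beta> where "\<beta> = anti_associated_coeff k \<eta> \<alpha>"
  have w: "w\<^sup>2 = x\<^sup>2 - 1" and r: "norm z < 1"
    using theI'[OF sqrt_branch_ex1[OF assms(7)]] by (simp_all add: w_def z_def sqrt_branch_def)
  have "z * (x + w) = 1" using w by (simp add: z_def algebra_simps power2_eq_square)
  then have z: "z \<noteq> 0" by auto
  have xz: "2 * x * z = z\<^sup>2 + 1" using w by (simp add: z_def algebra_simps power2_eq_square)
  note \<sigma> = Szego_prob_on(1)[OF assms(1)] and \<sigma>' = Szego_prob_on(1)[OF assms(5)]
  note nt = nontrivial_Szego[OF assms(1,2)]
  interpret A: circle_OPs "Szego \<mu>" \<alpha>
    using \<sigma> monic_OPs_verblunsky[OF \<sigma> nt] by unfold_locales (simp_all add: \<alpha>_def)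
  have OP': "monic_OPs (Szego \<mu>') (szego_poly \<beta>)"
    using assms(6) unfolding anti_associated_poly_def \<beta>_def \<eta>_def \<alpha>_def .
  interpret B: circle_OPs "Szego \<mu>'" \<beta>
    using \<sigma>' OP' by unfold_locales
  define F F' where "F = A.carath z" and "F' = B.carath z"
  have F: "F = w * S_function \<mu> x" and F': "F' = w * S_function \<mu>' x"
    unfolding F_def F'_def A.carath_def B.carath_def
    using carath_Szego[OF assms(1) z r xz] carath_Szego[OF assms(5) z r xz] by (simp_all add: z_def)

  \<comment> \<open>Nontriviality makes all norms positive; their consecutive ratios then force
    \<open>|\<alpha> n| < 1\<close>, as the lower bound on the reversed polynomials
    requires.\<close>
  have pos: "szego_weight \<alpha> n > 0" for n
    using nontrivial_poly_norm_pos[OF \<sigma> nt, of "szego_poly \<alpha> n"] A.norm_square_integral[of n]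
    by (metis coeff_szego coeff_0 zero_neq_one)
  have \<alpha>1: "norm (\<alpha> n) < 1" for n
  proof -
    have "1 - (norm (\<alpha> n))\<^sup>2 > 0"
      using pos[of n] pos[of "Suc n"] by (simp add: szego_weight_Suc zero_less_mult_iff)
    then show ?thesis by (simp add: abs_square_less_1)
  qed
  have \<beta>\<xi>: "\<beta> j = \<eta> j" if "j < k" for j using that by (simp add: \<beta>_def anti_associated_coeff_def)
  have \<beta>\<alpha>: "\<beta> (k + j) = \<alpha> j" for j by (simp add: \<beta>_def anti_associated_coeff_def)
  have sz\<beta>: "szego_poly \<beta> k = szego_poly \<eta> k" "second_kind_poly \<beta> k = second_kind_poly \<eta> k"
    using \<beta>\<xi> by (auto simp: second_kind_poly_def intro!: szego_poly_cong)
  have weight: "szego_weight \<beta> (k + n) = szego_weight \<beta> k * szego_weight \<alpha> n" for n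
    by (induction n) (simp_all add: szego_weight_Suc \<beta>\<alpha>)

  define f fs g gs where "f = poly (szego_poly \<eta> k) z" and "fs = poly (star (szego_poly \<eta> k)) z"
    and "g = poly (second_kind_poly \<eta> k) z" and "gs = poly (star (second_kind_poly \<eta> k)) z"
  define D N where "D = (fs - f) * F + (f + fs)" and "N = (g + gs) * F + (gs - g)"
  \<comment> \<open>\<open>X\<close> is the defect of the claimed relation after clearing the
    denominator; the analytic part of the proof shows that it is 0.\<close>
  define X where "X = D * F' - N"
  define e where "e n = poly (star (szego_poly \<alpha> n)) z * F - poly (star (second_kind_poly \<alpha> n)) z" for n
  define e' where "e' n = poly (star (szego_poly \<beta> n)) z * F' - poly (star (second_kind_poly \<beta> n)) z" for n
  \<comment> \<open>In the shift lemma the polynomials for the negated tail are those of the second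
    kind. Applying the lemma to \<open>- \<beta>\<close> exchanges the two kinds and gives
    \<open>star2\<close>.\<close>
  have star1: "2 * poly (star (szego_poly \<beta> (k + n))) z =
      (f + fs) * poly (star (szego_poly \<alpha> n)) z + (fs - f) * poly (star (second_kind_poly \<alpha> n)) z" for n
    using szego_poly_shift[OF z, of \<beta> k n] by (simp add: \<beta>\<alpha> sz\<beta> f_def fs_def second_kind_poly_def)
  have star2: "2 * poly (star (second_kind_poly \<beta> (k + n))) z =
      (g + gs) * poly (star (second_kind_poly \<alpha> n)) z + (gs - g) * poly (star (szego_poly \<alpha> n)) z" for n
    using szego_poly_shift[OF z, of "\<lambda>j. - \<beta> j" k n] sz\<beta>(2)
    by (simp add: \<beta>\<alpha> g_def gs_def second_kind_poly_def)
  \<comment> \<open>Eliminating the second kind polynomials of \<open>\<alpha>\<close> by means of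
    \<open>e n\<close> leaves the defect times the reversed polynomial, plus a multiple of
    \<open>e n\<close>.\<close>
  have key: "poly (star (szego_poly \<alpha> n)) z * X = 2 * e' (k + n) - ((g + gs) - (fs - f) * F') * e n" for n
    unfolding e'_def right_diff_distrib mult.assoc[symmetric] star1 star2
    by (simp add: X_def D_def N_def e_def algebra_simps)
  define C where "C = 2 * (2 / (1 - norm z) * sqrt (szego_weight \<beta> k)) + norm ((g + gs) - (fs - f) * F') * (2 / (1 - norm z))"
  have bound: "sqrt (1 - (norm z)\<^sup>2) * norm X \<le> C * norm z ^ n" for n
  proof -
    let ?p = "sqrt (szego_weight \<alpha> n)"
    have p: "?p > 0" using pos by simp
    have wk: "szego_weight \<beta> k \<ge> 0"
      unfolding B.norm_square_integral[symmetric] by (intro integral_nonneg_AE) simp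
    have "(1 - (norm z)\<^sup>2) * szego_weight \<alpha> n \<le> (norm (poly (star (szego_poly \<alpha> n)) z))\<^sup>2"
      using star_szego_lower_bound[of z \<alpha> n, OF z r \<alpha>1] 
        mult_nonneg_nonneg[OF zero_le_power2[of "norm z"] zero_le_power2[of "norm (poly (szego_poly \<alpha> n) z)"]]
      by linarith
    then have low: "sqrt (1 - (norm z)\<^sup>2) * ?p \<le> norm (poly (star (szego_poly \<alpha> n)) z)"
      by (metis real_sqrt_mult real_le_lsqrt norm_ge_zero)
    have E: "norm (e n) \<le> 2 / (1 - norm z) * norm z ^ n * ?p"
      using A.star_remainder_bound[OF z r, of n] by (simp add: e_def F_def)
    have "norm (e' (k + n)) \<le> 2 / (1 - norm z) * norm z ^ (k + n) * sqrt (szego_weight \<beta> (k + n))"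
      using B.star_remainder_bound[OF z r, of "k + n"] by (simp add: e'_def F'_def)
    also have "\<dots> \<le> 2 / (1 - norm z) * norm z ^ n * (sqrt (szego_weight \<beta> k) * ?p)"
      unfolding weight real_sqrt_mult using r wk pos[of n]
      by (intro mult_mono power_decreasing mult_nonneg_nonneg) auto
    finally have E': "norm (e' (k + n)) \<le> 2 / (1 - norm z) * norm z ^ n * (sqrt (szego_weight \<beta> k) * ?p)" .
    \<comment> \<open>Both sides of the estimate carry the factor \<open>?p\<close>, which may tend
      to 0. It cancels, since the weights of \<open>\<beta>\<close> split off those of
      \<open>\<alpha>\<close>, and the geometric decay remains.\<close>
    have "(sqrt (1 - (norm z)\<^sup>2) * norm X) * ?p = (sqrt (1 - (norm z)\<^sup>2) * ?p) * norm X" by simp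
    also have "\<dots> \<le> norm (poly (star (szego_poly \<alpha> n)) z) * norm X"
      by (intro mult_right_mono low) simp
    also have "\<dots> = norm (2 * e' (k + n) - ((g + gs) - (fs - f) * F') * e n)"
      by (simp only: norm_mult[symmetric] key)
    also have "\<dots> \<le> 2 * norm (e' (k + n)) + norm ((g + gs) - (fs - f) * F') * norm (e n)"
      by (rule order_trans[OF norm_triangle_ineq4]) (simp add: norm_mult)
    also have "\<dots> \<le> 2 * (2 / (1 - norm z) * norm z ^ n * (sqrt (szego_weight \<beta> k) * ?p))
        + norm ((g + gs) - (fs - f) * F') * (2 / (1 - norm z) * norm z ^ n * ?p)"
      using E E' by (intro add_mono mult_left_mono) auto
    also have "\<dots> = (C * norm z ^ n) * ?p" by (simp add: C_def algebra_simps)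
    finally show ?thesis using p by (simp only: mult_le_cancel_right_pos)
  qed
  have "(\<lambda>n. C * norm z ^ n) \<longlonglongrightarrow> C * 0"
    by (intro tendsto_mult tendsto_const LIMSEQ_realpow_zero) (use r in auto)
  then have "sqrt (1 - (norm z)\<^sup>2) * norm X \<le> C * 0"
    using bound by (intro LIMSEQ_le_const) auto
  moreover have "sqrt (1 - (norm z)\<^sup>2) > 0" using r by (simp add: abs_square_less_1)
  ultimately have "norm X \<le> 0" by (simp add: mult_le_0_iff)
  then have X0: "D * F' = N" by (simp add: X_def)

  have "\<bar>\<xi> j\<bar> \<noteq> 1" if "j < k" for j
    using assms(4)[OF that] by auto
  then have "szego_weight \<eta> k \<noteq> 0"
    unfolding szego_weight_def by (auto simp: \<eta>_def abs_square_eq_1)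
  then have wr: "g * fs + gs * f \<noteq> 0"
    using szego_wronskian[OF z, of \<eta> k] z by (simp add: f_def fs_def g_def gs_def)
  have "D \<noteq> 0"
  proof
    assume D: "D = 0"
    then have "N = 0" using X0 by simp
    \<comment> \<open>This combination eliminates \<open>F\<close> and leaves the determinant of
      \<open>Upsilon\<close>, so \<open>D\<close> and \<open>N\<close> cannot vanish
      together.\<close>
    have "2 * (g * fs + gs * f) = (g + gs) * D - (fs - f) * N"
      by (simp add: D_def N_def algebra_simps)
    then have "2 * (g * fs + gs * f) = 0" by (simp only: D \<open>N = 0\<close>) simp
    then show False using wr by (metis mult_eq_0_iff zero_neq_numeral)
  qed
  then show ?thesis
    using X0 unfolding lin_frac_eq_def Upsilon_def Let_def \<eta>_def[symmetric] w_def[symmetric] z_def[symmetric]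
    by (simp add: F[symmetric] F'[symmetric] D_def N_def f_def fs_def g_def gs_def field_simps)
qed

end
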